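(* Let $T$ be a piecewise linear expanding map with essential branch number $r_T=3$, having exactly $n_1$ branches of slope $x_1$, $n_2$ branches of slope $x_2$ and $n_3$ branches of slope $x_3$ (with $x_1<x_2<x_3$ and $n_1,n_2,n_3\ge 1$). Then the number of Lyapunov inflections of $T$ is less than or equal to $6$.
   Context: A (finitely branched) piecewise linear expanding map is a map $T: X=\bigcup_{i=1}^n X_i\to[0,1]$, where $X_1,\dots,X_n\subset[0,1]$ are closed intervals with pairwise disjoint interiors, each $T|_{X_i}$ is affine and maps $X_i$ onto $[0,1]$, and $|T'|$ is constant equal to $|X_i|^{-1}>1$ on $X_i$ (this number is the slope of the branch; ambiguities at common endpoints are irrelevant). The essential branch number $r_T$ is the number of distinct slopes. The repeller is $\Lambda=\bigcap_{k\ge 0}T^{-k}(X)$. The Lyapunov exponent at $x\in\Lambda$ is $\lambda(x)=\lim_{m\to\infty}\frac1m\log|(T^m)'(x)|$ when the limit exists. The Lyapunov spectrum is $L(\alpha)=\dim_H\{x\in\Lambda:\lambda(x)=\alpha\}$ (Hausdorff dimension), defined for those $\alpha$ with nonempty level set; its domain is $[\log s_{\min},\log s_{\max}]$, where $s_{\min},s_{\max}$ are the least and largest slopes. A Lyapunov inflection of $T$ is a point $\alpha\in(\log s_{\min},\log s_{\max})$ with $L''(\alpha)=0$. If the slopes are not all equal, let $F(t)$ be the sum over all branches of (slope)$^t$; here $F(t)=n_1x_1^t+n_2x_2^t+n_3x_3^t$. Then $\alpha(t)=F'(t)/F(t)$ is an increasing bijection from $\mathbb{R}$ onto $(\log s_{\min},\log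 s_{\max})$, and $L(\alpha(t))=\frac{F(t)\log F(t)}{F'(t)}-t$. *)

theory Defs
  imports "HOL-Analysis.Analysis"
begin

section \<open>Hausdorff measure and dimension\<close>

text \<open>The \<open>s\<close>-th power of the diameter, with the conventions that \<open>0\<^sup>0 = 1\<close> for nonempty sets
  (whereas \<open>0 powr 0 = 0\<close>) and that the empty set always contributes \<open>0\<close>.\<close>

definition diam_pow :: "real \<Rightarrow> 'a::metric_space set \<Rightarrow> ennreal" where
  "diam_pow s U = (if U = {} then 0 else if s = 0 then 1 else ennreal (diameter U powr s))"

text \<open>Boundedness is required explicitly because \<^const>\<open>diameter\<close> is meaningless on unbounded sets.\<close>

definition hausdorff_pre_measure :: "real \<Rightarrow> real \<Rightarrow> 'a::metric_space set \<Rightarrow> ennreal" where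
  "hausdorff_pre_measure s \<delta> A =
     (INF U \<in> {U :: nat \<Rightarrow> 'a set. A \<subseteq> (\<Union>k. U k) \<and> (\<forall>k. bounded (U k) \<and> diameter (U k) \<le> \<delta>)}.
        (\<Sum>k. diam_pow s (U k)))"

definition hausdorff_measure :: "real \<Rightarrow> 'a::metric_space set \<Rightarrow> ennreal" where
  "hausdorff_measure s A = (SUP \<delta> \<in> {0<..}. hausdorff_pre_measure s \<delta> A)"

definition hausdorff_dim :: "'a::metric_space set \<Rightarrow> ennreal" where
  "hausdorff_dim A = (INF s \<in> {s. 0 \<le> s \<and> hausdorff_measure s A = 0}. ennreal s)"

section \<open>Piecewise linear expanding maps\<close>

definition pl_domain :: "nat \<Rightarrow> (nat \<Rightarrow> real) \<Rightarrow> (nat \<Rightarrow> real) \<Rightarrow> real set" where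
  "pl_domain n a b = (\<Union>i<n. {a i..b i})"

definition slope :: "(nat \<Rightarrow> real) \<Rightarrow> (nat \<Rightarrow> real) \<Rightarrow> nat \<Rightarrow> real" where
  "slope a b i = 1 / (b i - a i)"

text \<open>The \<open>i\<close>-th branch, \<open>i < n\<close>, lives on \<open>X\<^sub>i = {a i..b i}\<close> and is \<open>x \<mapsto> p i * x + q i\<close>.
  At an endpoint shared by two of the intervals, \<open>T\<close> may follow either branch. Values of \<open>T\<close> outside
  \<^term>\<open>pl_domain n a b\<close> are irrelevant. Since the branch maps \<open>X\<^sub>i\<close> onto \<open>[0,1]\<close>, automatically
  \<open>\<bar>p i\<bar> = slope a b i\<close>.\<close>

definition pl_expanding_map ::
  "nat \<Rightarrow> (nat \<Rightarrow> real) \<Rightarrow> (nat \<Rightarrow> real) \<Rightarrow> (real \<Rightarrow> real) \<Rightarrow> bool" where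
  "pl_expanding_map n a b T \<longleftrightarrow>
     1 \<le> n \<and>
     (\<forall>i<n. 0 \<le> a i \<and> a i < b i \<and> b i \<le> 1 \<and> slope a b i > 1) \<and>
     (\<forall>i<n. \<forall>j<n. i \<noteq> j \<longrightarrow> interior {a i..b i} \<inter> interior {a j..b j} = {}) \<and>
     (\<exists>p q :: nat \<Rightarrow> real.
        (\<forall>i<n. (\<lambda>x. p i * x + q i) ` {a i..b i} = {0..1}) \<and>
        (\<forall>x \<in> pl_domain n a b. \<exists>i<n. x \<in> {a i..b i} \<and> T x = p i * x + q i))"

definition slopes :: "nat \<Rightarrow> (nat \<Rightarrow> real) \<Rightarrow> (nat \<Rightarrow> real) \<Rightarrow> real set" where
  "slopes n a b = slope a b ` {..<n}"

definition essential_branch_number :: "nat \<Rightarrow> (nat \<Rightarrow> real) \<Rightarrow> (nat \<Rightarrow> real) \<Rightarrow> nat" where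
  "essential_branch_number n a b = card (slopes n a b)"

section \<open>Lyapunov spectrum\<close>

text \<open>In this section \<open>X\<close> is the domain of \<open>T\<close>.\<close>

definition repeller :: "real set \<Rightarrow> (real \<Rightarrow> real) \<Rightarrow> real set" where
  "repeller X T = (\<Inter>k. (T ^^ k) -` X)"

definition iterate_domain :: "real set \<Rightarrow> (real \<Rightarrow> real) \<Rightarrow> nat \<Rightarrow> real set" where
  "iterate_domain X T m = {y. \<forall>k<m. (T ^^ k) y \<in> X}"

text \<open>The derivative of \<open>T\<^sup>m\<close> is taken within the set where \<open>T\<^sup>m\<close> is defined, so it is one-sided at
  endpoints of that set. It may fail to exist at the countably many points whose orbit
  meets a common endpoint of two intervals; such points then have no Lyapunov exponent.\<close>

definition has_lyapunov_exponent :: "real set \<Rightarrow> (real \<Rightarrow> real) \<Rightarrow> real \<Rightarrow> real \<Rightarrow> bool" where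
  "has_lyapunov_exponent X T x \<alpha> \<longleftrightarrow>
     (\<exists>D :: nat \<Rightarrow> real.
        (\<forall>m. ((T ^^ m) has_real_derivative D m) (at x within iterate_domain X T m)) \<and>
        (\<lambda>m. 1 / real m * ln \<bar>D m\<bar>) \<longlonglongrightarrow> \<alpha>)"

definition lyapunov_spectrum :: "real set \<Rightarrow> (real \<Rightarrow> real) \<Rightarrow> real \<Rightarrow> real" where
  "lyapunov_spectrum X T \<alpha> =
     enn2real (hausdorff_dim {x \<in> repeller X T. has_lyapunov_exponent X T x \<alpha>})"

definition has_second_derivative :: "(real \<Rightarrow> real) \<Rightarrow> real \<Rightarrow> real \<Rightarrow> bool" where
  "has_second_derivative f c x \<longleftrightarrow>
     (\<exists>f'. (\<forall>\<^sub>F y in nhds x. (f has_real_derivative f' y) (at y)) \<and>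
           (f' has_real_derivative c) (at x))"

definition lyapunov_inflections ::
  "nat \<Rightarrow> (nat \<Rightarrow> real) \<Rightarrow> (nat \<Rightarrow> real) \<Rightarrow> (real \<Rightarrow> real) \<Rightarrow> real set" where
  "lyapunov_inflections n a b T =
     {\<alpha>. ln (Min (slopes n a b)) < \<alpha> \<and> \<alpha> < ln (Max (slopes n a b)) \<and>
          has_second_derivative (lyapunov_spectrum (pl_domain n a b) T) 0 \<alpha>}"

end

theory Submission
  imports Defs "HOL-Probability.Hoeffding"
begin

text \<open>
  Let \<open>F t\<close> be the sum of the \<open>t\<close>-th powers of the slopes, \<open>P = ln F\<close> and \<open>\<alpha> = P'\<close>. Up to a countable
  set, the level set of \<open>\<alpha> t\<close> consists of the points whose itinerary has mean log-slope \<open>\<alpha> t\<close>. Covering it with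
  cylinders bounds its dimension above by \<open>P / P' - t\<close>; the Bernoulli measure giving a branch of slope \<open>x\<close> the
  weight \<open>x powr t / F t\<close> and the strong law of large numbers give the same lower bound. Differentiating
  \<open>L (P' t) = P t / P' t - t\<close> twice shows that \<open>L'' = 0\<close> at \<open>P' t\<close> forces \<open>h = P - P'\<^sup>2 / (2 P'')\<close> to vanish
  at \<open>t\<close>. Since \<open>h' = P'\<^sup>2 P''' / (2 P''\<^sup>2)\<close> and \<open>F\<^sup>3 P'''\<close> is a sum of seven exponentials with three sign
  changes, \<open>h\<close> has at most four zeros.
\<close>

section \<open>Hausdorff null sets\<close>

text \<open>Derivatives of \<open>T ^^ m\<close> are delicate at shared endpoints, so level sets are
  exchanged for sets defined by itineraries alone; the two differ inside the countable set of
  preimages of endpoints, which is null for every positive exponent. The dimension only records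
  which exponents give measure zero, so Hausdorff measure enters solely through null sets. The form
  of h matters for the count. The bare numerator 2 P P'' - P'^2 has derivative 2 P P''', and P
  contributes a zero of its own. Dividing by 2 P'' > 0 makes P' cancel in the derivative and leaves
  P''' as the only factor that can vanish. In F^3 P''' the ten products of three exponentials lose
  the three pure cubes, since a one-point distribution has third cumulant zero. The order of the
  other exponents and the sign of one coefficient depend on which gap between log-slopes is larger,
  yet both arrangements have at most three sign changes. Differentiability of L is part of the
  notion of inflection, so the chain rule can be applied directly along the parametrisation by
  t.\<close>

lemma hausdorff_measure_eq_0_iff:
  "hausdorff_measure s A = 0 \<longleftrightarrow>
    (\<forall>\<delta>>0. \<forall>e>0. \<exists>U. A \<subseteq> (\<Union>k. U k) \<and> (\<forall>k::nat. bounded (U k) \<and> diameter (U k) \<le> \<delta>) \<and>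
      (\<Sum>k. diam_pow s (U k)) < ennreal e)"
proof -
  have pre: "hausdorff_pre_measure s \<delta> A = 0 \<longleftrightarrow>
      (\<forall>e>0. \<exists>U. A \<subseteq> (\<Union>k. U k) \<and> (\<forall>k::nat. bounded (U k) \<and> diameter (U k) \<le> \<delta>) \<and>
      (\<Sum>k. diam_pow s (U k)) < ennreal e)" (is "_ = ?R") for \<delta>
  proof -
    have "hausdorff_pre_measure s \<delta> A = 0 \<longleftrightarrow> (\<forall>e>0. hausdorff_pre_measure s \<delta> A < ennreal e)"
    proof
      assume *: "\<forall>e>0. hausdorff_pre_measure s \<delta> A < ennreal e"
      have "hausdorff_pre_measure s \<delta> A \<le> 0"
        by (rule ennreal_le_epsilon) (use * in \<open>auto intro: less_imp_le\<close>)
      then show "hausdorff_pre_measure s \<delta> A = 0" by simp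
    qed simp
    also have "\<dots> \<longleftrightarrow> ?R"
      unfolding hausdorff_pre_measure_def INF_less_iff by auto
    finally show ?thesis .
  qed
  have "hausdorff_measure s A = 0 \<longleftrightarrow> (\<forall>\<delta>>0. hausdorff_pre_measure s \<delta> A = 0)"
    unfolding hausdorff_measure_def
    by (subst bot_ennreal[symmetric], subst SUP_bot_conv) (auto simp: bot_ennreal)
  then show ?thesis unfolding pre .
qed

lemma hausdorff_measure_eq_0_mono:
  assumes "hausdorff_measure s B = 0" "A \<subseteq> B"
  shows "hausdorff_measure s A = 0"
  using assms unfolding hausdorff_measure_eq_0_iff by (meson order_trans)

text \<open>The i-th set receives a cover of cost below (e/2) / 2^(i+1), and
  \<open>prod_decode\<close> merges all covers into one sequence. Aiming at e/2 restores the strict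
  inequality that is lost when the bounds are summed.\<close>

lemma hausdorff_measure_UN_eq_0:
  fixes A :: "nat \<Rightarrow> 'a::metric_space set"
  assumes "\<And>i. hausdorff_measure s (A i) = 0"
  shows "hausdorff_measure s (\<Union>i. A i) = 0"
  unfolding hausdorff_measure_eq_0_iff
proof (intro allI impI)
  fix \<delta> e :: real assume "\<delta> > 0" "e > 0"
  have "\<forall>i. \<exists>U. A i \<subseteq> (\<Union>k. U k) \<and> (\<forall>k::nat. bounded (U k) \<and> diameter (U k) \<le> \<delta>) \<and>
      (\<Sum>k. diam_pow s (U k)) < ennreal ((e/2) * (1/2) ^ Suc i)"
    using assms \<open>\<delta> > 0\<close> \<open>e > 0\<close> unfolding hausdorff_measure_eq_0_iff by simp
  then obtain U where U: "\<And>i. A i \<subseteq> (\<Union>k. U i k)"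
      "\<And>i k::nat. bounded (U i k) \<and> diameter (U i k) \<le> \<delta>"
      "\<And>i. (\<Sum>k. diam_pow s (U i k)) < ennreal ((e/2) * (1/2) ^ Suc i)"
    by metis
  define V where "V = (\<lambda>j. case prod_decode j of (i,k) \<Rightarrow> U i k)"
  have V: "V j = (\<lambda>(i,k). U i k) (prod_decode j)" for j by (simp add: V_def)
  have "(\<Sum>j. diam_pow s (V j)) = (\<Sum>j. (\<lambda>(i,k). diam_pow s (U i k)) (prod_decode j))"
    by (simp add: V_def case_prod_unfold)
  also have "\<dots> = (\<Sum>i. \<Sum>k. diam_pow s (U i k))"
    by (rule suminf_ennreal_2dimen) simp
  also have "\<dots> \<le> (\<Sum>i. ennreal ((e/2) * (1/2) ^ Suc i))"
    using U(3) by (intro suminf_le) (auto intro: less_imp_le)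
  also have "\<dots> = ennreal (e/2)"
  proof (rule suminf_ennreal_eq)
    show "(\<lambda>i. (e/2) * (1/2) ^ Suc i) sums (e/2)"
      using sums_mult[OF power_half_series, of "e/2"] by simp
  qed (use \<open>e > 0\<close> in auto)
  also have "\<dots> < ennreal e" using \<open>e > 0\<close> by (simp add: ennreal_less_iff)
  finally have "(\<Sum>j. diam_pow s (V j)) < ennreal e" .
  moreover have "(\<Union>i. A i) \<subseteq> (\<Union>j. V j)"
  proof
    fix x assume "x \<in> (\<Union>i. A i)"
    then obtain i k where "x \<in> U i k" using U(1) by blast
    then have "x \<in> V (prod_encode (i,k))" by (simp add: V_def)
    then show "x \<in> (\<Union>j. V j)" by blast
  qed
  moreover have "\<forall>k. bounded (V k) \<and> diameter (V k) \<le> \<delta>"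
    using U(2) by (simp add: V_def case_prod_unfold)
  ultimately show "\<exists>U. (\<Union>i. A i) \<subseteq> (\<Union>k. U k) \<and> (\<forall>k::nat. bounded (U k) \<and> diameter (U k) \<le> \<delta>) \<and>
      (\<Sum>k. diam_pow s (U k)) < ennreal e" by blast
qed

text \<open>A singleton costs 0 as soon as s is positive; at s = 0 it would cost 1.\<close>

lemma hausdorff_measure_countable_eq_0:
  fixes A :: "'a::metric_space set"
  assumes "countable A" "s > 0"
  shows "hausdorff_measure s A = 0"
proof (cases "A = {}")
  case False
  have "hausdorff_measure s {x} = 0" for x :: 'a
    unfolding hausdorff_measure_eq_0_iff
    using assms(2) by (intro allI impI exI[of _ "\<lambda>_. {x}"]) (auto simp: diam_pow_def)
  then have "hausdorff_measure s (\<Union>i. {from_nat_into A i}) = 0"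
    by (rule hausdorff_measure_UN_eq_0)
  moreover have "A = (\<Union>i. {from_nat_into A i})"
    using range_from_nat_into[OF False assms(1)] by auto
  ultimately show ?thesis by simp
next
  case True
  show ?thesis
    unfolding hausdorff_measure_eq_0_iff True
    by (intro allI impI exI[of _ "\<lambda>_. {}"]) (auto simp: diam_pow_def)
qed

lemma hausdorff_measure_Un_eq_0:
  assumes "hausdorff_measure s A = 0" "hausdorff_measure s B = 0"
  shows "hausdorff_measure s (A \<union> B) = 0"
proof -
  have "A \<union> B \<subseteq> (\<Union>i::nat. if i = 0 then A else B)"
    using UN_upper[of "0::nat" UNIV "\<lambda>i. if i = 0 then A else B"]
      UN_upper[of "1::nat" UNIV "\<lambda>i. if i = 0 then A else B"] by simp
  moreover have "hausdorff_measure s (\<Union>i::nat. if i = 0 then A else B) = 0"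
    using assms by (intro hausdorff_measure_UN_eq_0) simp
  ultimately show ?thesis by (rule hausdorff_measure_eq_0_mono[rotated])
qed

text \<open>On diameters at most 1 a larger exponent gives a smaller power, so covers are taken at
  scale \<open>min \<delta> 1\<close>.\<close>

lemma hausdorff_measure_eq_0_exponent_mono:
  assumes "hausdorff_measure s A = 0" "0 \<le> s" "s \<le> t"
  shows "hausdorff_measure t A = 0"
  unfolding hausdorff_measure_eq_0_iff
proof (intro allI impI)
  fix \<delta> e :: real assume "\<delta> > 0" "e > 0"
  then obtain U where U: "A \<subseteq> (\<Union>k. U k)" "\<forall>k::nat. bounded (U k) \<and> diameter (U k) \<le> min \<delta> 1"
      "(\<Sum>k. diam_pow s (U k)) < ennreal e"
    using assms(1)[unfolded hausdorff_measure_eq_0_iff, rule_format, of "min \<delta> 1" e] by auto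
  have "diam_pow t (U k) \<le> diam_pow s (U k)" for k
  proof -
    have "0 \<le> diameter (U k)" "diameter (U k) \<le> 1"
      using U(2) by (auto simp: diameter_ge_0)
    then show ?thesis
      using assms(2,3)
      by (auto simp: diam_pow_def powr_mono' ennreal_leI powr_le1 simp flip: ennreal_1)
  qed
  then have "(\<Sum>k. diam_pow t (U k)) \<le> (\<Sum>k. diam_pow s (U k))"
    by (intro suminf_le) auto
  with U show "\<exists>U. A \<subseteq> (\<Union>k. U k) \<and> (\<forall>k::nat. bounded (U k) \<and> diameter (U k) \<le> \<delta>) \<and>
      (\<Sum>k. diam_pow t (U k)) < ennreal e"
    by (intro exI[of _ U]) (auto intro: le_less_trans)
qed

lemma finite_cover_imp_sequence_cover:
  assumes "finite I" "A \<subseteq> (\<Union>i\<in>I. U i)" "\<And>i. i \<in> I \<Longrightarrow> bounded (U i) \<and> diameter (U i) \<le> \<delta>" "0 \<le> \<delta>"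
  shows "\<exists>V. A \<subseteq> (\<Union>k. V k) \<and> (\<forall>k::nat. bounded (V k) \<and> diameter (V k) \<le> \<delta>) \<and>
      (\<Sum>k. diam_pow s (V k)) = (\<Sum>i\<in>I. diam_pow s (U i))"
proof -
  obtain h where h: "bij_betw h {0..<card I} I"
    using ex_bij_betw_nat_finite[OF assms(1)] by blast
  \<comment> \<open>Padding with empty sets is free for every exponent, s = 0 included, by the
    convention in \<open>diam_pow\<close>.\<close>
  define V where "V = (\<lambda>k. if k < card I then U (h k) else {})"
  have "(\<Sum>k. diam_pow s (V k)) = (\<Sum>k<card I. diam_pow s (V k))"
    by (rule suminf_finite) (auto simp: V_def diam_pow_def)
  also have "\<dots> = (\<Sum>k\<in>{0..<card I}. diam_pow s (U (h k)))"
    by (intro sum.cong) (auto simp: V_def)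
  also have "\<dots> = (\<Sum>i\<in>I. diam_pow s (U i))"
    using h by (rule sum.reindex_bij_betw)
  finally have 1: "(\<Sum>k. diam_pow s (V k)) = (\<Sum>i\<in>I. diam_pow s (U i))" .
  have 2: "A \<subseteq> (\<Union>k. V k)"
  proof
    fix x assume "x \<in> A"
    then obtain i where "i \<in> I" "x \<in> U i" using assms(2) by blast
    then obtain k where "k < card I" "h k = i"
      using h by (metis atLeastLessThan_iff bij_betw_imp_surj_on imageE)
    then show "x \<in> (\<Union>k. V k)" using \<open>x \<in> U i\<close> by (auto simp: V_def intro!: exI[of _ k])
  qed
  have "h k \<in> I" if "k < card I" for k
    using h that by (auto simp: bij_betw_def)
  then have "\<forall>k. bounded (V k) \<and> diameter (V k) \<le> \<delta>"
    using assms(3,4) by (auto simp: V_def)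
  with 1 2 show ?thesis by blast
qed

text \<open>The lower bound is tested at positive exponents only, because countable exceptional sets
  are null only there. Testing at the midpoint of s and d handles s = 0 as well.\<close>

lemma hausdorff_dim_eqI:
  assumes "0 \<le> d" "\<And>s. d < s \<Longrightarrow> hausdorff_measure s A = 0"
    and "\<And>s. 0 < s \<Longrightarrow> s < d \<Longrightarrow> hausdorff_measure s A \<noteq> 0"
  shows "hausdorff_dim A = ennreal d"
proof (rule antisym)
  show "hausdorff_dim A \<le> ennreal d"
  proof (rule ennreal_le_epsilon)
    fix e :: real assume "0 < e"
    then have "hausdorff_dim A \<le> ennreal (d + e)"
      unfolding hausdorff_dim_def using assms by (intro INF_lower) auto
    then show "hausdorff_dim A \<le> ennreal d + ennreal e"
      using assms(1) \<open>0 < e\<close> by (simp add: ennreal_plus)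
  qed
  show "ennreal d \<le> hausdorff_dim A"
    unfolding hausdorff_dim_def
  proof (rule INF_greatest)
    fix s assume "s \<in> {s. 0 \<le> s \<and> hausdorff_measure s A = 0}"
    then have s: "0 \<le> s" "hausdorff_measure s A = 0" by auto
    have "d \<le> s"
    proof (rule ccontr)
      assume "\<not> d \<le> s"
      then have "hausdorff_measure ((s + d)/2) A = 0"
        using hausdorff_measure_eq_0_exponent_mono[OF s(2,1)] by simp
      then show False using assms(3)[of "(s+d)/2"] s(1) \<open>\<not> d \<le> s\<close> by simp
    qed
    then show "ennreal d \<le> ennreal s" by (rule ennreal_leI)
  qed
qed

section \<open>Cylinders and itineraries\<close>

text \<open>The affine formulas are composed along a prescribed word on the whole line, whether or
  not the orbit stays in the branches. Each iterate is thus globally affine in x, and admissibility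
  becomes a separate condition on its values.\<close>

primrec branch_iter ::
  "(nat \<Rightarrow> real) \<Rightarrow> (nat \<Rightarrow> real) \<Rightarrow> (nat \<Rightarrow> nat) \<Rightarrow> nat \<Rightarrow> real \<Rightarrow> real" where
  "branch_iter p q w 0 x = x"
| "branch_iter p q w (Suc m) x = p (w m) * branch_iter p q w m x + q (w m)"

lemma branch_iter_cong:
  "(\<And>k. k < m \<Longrightarrow> w k = w' k) \<Longrightarrow> branch_iter p q w m x = branch_iter p q w' m x"
  by (induction m) auto

lemma branch_iter_affine:
  "branch_iter p q w m x = branch_iter p q w m 0 + (\<Prod>k<m. p (w k)) * x"
  by (induction m) (auto simp: algebra_simps)

text \<open>The map itself is kept out: coding, covers and measures depend only on the branch
  formulas, and the choice made by the map at shared endpoints enters later.\<close>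

locale pl_branches =
  fixes n :: nat and a b p q :: "nat \<Rightarrow> real"
  assumes n_pos: "n > 0"
    and branch_bounds: "\<And>i. i < n \<Longrightarrow> 0 \<le> a i \<and> a i < b i \<and> b i \<le> 1 \<and> slope a b i > 1"
    and branch_disjoint: "\<And>i j. i < n \<Longrightarrow> j < n \<Longrightarrow> i \<noteq> j \<Longrightarrow> {a i<..<b i} \<inter> {a j<..<b j} = {}"
    and branch_onto: "\<And>i. i < n \<Longrightarrow> (\<lambda>x. p i * x + q i) ` {a i..b i} = {0..1}"
begin

text \<open>A nonconstant affine function is strictly monotone, so the points u and v where it takes
  the extreme values 0 and 1 have to be the endpoints.\<close>

lemma branch_endpoints:
  assumes "i < n"
  shows "p i > 0 \<and> p i * a i + q i = 0 \<and> p i * b i + q i = 1 \<or>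
    p i < 0 \<and> p i * b i + q i = 0 \<and> p i * a i + q i = 1"
proof -
  have ab: "a i < b i" using branch_bounds[OF assms] by simp
  have mem: "p i * x + q i \<in> {0..1}" if "a i \<le> x" "x \<le> b i" for x
    using branch_onto[OF assms] that by (metis atLeastAtMost_iff imageI)
  obtain u where u: "a i \<le> u" "u \<le> b i" "p i * u + q i = 0"
  proof -
    have "0 \<in> (\<lambda>x. p i * x + q i) ` {a i..b i}" using branch_onto[OF assms] by simp
    then show ?thesis using that by auto
  qed
  obtain v where v: "a i \<le> v" "v \<le> b i" "p i * v + q i = 1"
  proof -
    have "1 \<in> (\<lambda>x. p i * x + q i) ` {a i..b i}" using branch_onto[OF assms] by simp
    then show ?thesis using that by auto
  qed
  have ma: "0 \<le> p i * a i + q i" "p i * a i + q i \<le> 1" and mb: "0 \<le> p i * b i + q i" "p i * b i + q i \<le> 1"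
    using mem[of "a i"] mem[of "b i"] ab by auto
  have "p i \<noteq> 0" using u(3) v(3) by auto
  then consider "p i > 0" | "p i < 0" by linarith
  then show ?thesis
  proof cases
    case 1
    have "p i * a i \<le> p i * u" "p i * v \<le> p i * b i" using 1 u v by auto
    then show ?thesis using 1 ma mb u v by linarith
  next
    case 2
    have "p i * a i \<ge> p i * v" "p i * u \<ge> p i * b i" using 2 u v by (auto simp: mult_le_cancel_left)
    then show ?thesis using 2 ma mb u v by linarith
  qed
qed

text \<open>These equivalences hold for every real x, not only on the branch interval. Membership of
  the last iterate in [0,1] can therefore be pulled back through all earlier steps.\<close>

lemma branch_mem_iff: "i < n \<Longrightarrow> p i * x + q i \<in> {0..1} \<longleftrightarrow> x \<in> {a i..b i}"
  and branch_mem_open_iff: "i < n \<Longrightarrow> p i * x + q i \<in> {0<..<1} \<longleftrightarrow> x \<in> {a i<..<b i}"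
proof -
  assume i: "i < n"
  have le: "p i * s \<le> p i * t \<longleftrightarrow> (if p i > 0 then s \<le> t else t \<le> s)" if "p i \<noteq> 0" for s t
    using that by (auto simp: mult_le_cancel_left)
  have lt: "p i * s < p i * t \<longleftrightarrow> (if p i > 0 then s < t else t < s)" if "p i \<noteq> 0" for s t
    using that by (auto simp: mult_less_cancel_left)
  show "p i * x + q i \<in> {0..1} \<longleftrightarrow> x \<in> {a i..b i}"
    using branch_endpoints[OF i]
  proof
    assume h: "p i > 0 \<and> p i * a i + q i = 0 \<and> p i * b i + q i = 1"
    have "p i * x + q i \<in> {0..1} \<longleftrightarrow> p i * a i \<le> p i * x \<and> p i * x \<le> p i * b i"
      unfolding atLeastAtMost_iff using h by (intro conj_cong) linarith+
    then show ?thesis using h le by auto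
  next
    assume h: "p i < 0 \<and> p i * b i + q i = 0 \<and> p i * a i + q i = 1"
    have "p i * x + q i \<in> {0..1} \<longleftrightarrow> p i * b i \<le> p i * x \<and> p i * x \<le> p i * a i"
      unfolding atLeastAtMost_iff using h by (intro conj_cong) linarith+
    then show ?thesis using h le by auto
  qed
  show "p i * x + q i \<in> {0<..<1} \<longleftrightarrow> x \<in> {a i<..<b i}"
    using branch_endpoints[OF i]
  proof
    assume h: "p i > 0 \<and> p i * a i + q i = 0 \<and> p i * b i + q i = 1"
    have "p i * x + q i \<in> {0<..<1} \<longleftrightarrow> p i * a i < p i * x \<and> p i * x < p i * b i"
      unfolding greaterThanLessThan_iff using h by (intro conj_cong) linarith+
    then show ?thesis using h lt by auto
  next
    assume h: "p i < 0 \<and> p i * b i + q i = 0 \<and> p i * a i + q i = 1"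
    have "p i * x + q i \<in> {0<..<1} \<longleftrightarrow> p i * b i < p i * x \<and> p i * x < p i * a i"
      unfolding greaterThanLessThan_iff using h by (intro conj_cong) linarith+
    then show ?thesis using h lt by auto
  qed
qed

lemma abs_branch_slope: "i < n \<Longrightarrow> \<bar>p i\<bar> = slope a b i"
proof -
  assume i: "i < n"
  have "\<bar>p i\<bar> * (b i - a i) = 1"
    using branch_endpoints[OF i] by (auto simp: algebra_simps)
  then show ?thesis using branch_bounds[OF i] by (simp add: slope_def field_simps)
qed

lemma abs_branch_slope_gt_1: "i < n \<Longrightarrow> \<bar>p i\<bar> > 1"
  using abs_branch_slope branch_bounds by simp

definition log_slope :: "nat \<Rightarrow> real" where "log_slope i = ln \<bar>p i\<bar>"

definition log_slope_sum :: "(nat \<Rightarrow> nat) \<Rightarrow> nat \<Rightarrow> real" where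
  "log_slope_sum w m = (\<Sum>k<m. log_slope (w k))"

abbreviation biter :: "(nat \<Rightarrow> nat) \<Rightarrow> nat \<Rightarrow> real \<Rightarrow> real" where
  "biter \<equiv> branch_iter p q"

text \<open>Only the last iterate is constrained. For letters below n each formula pulls [0,1] back
  to its own branch interval, so the earlier iterates follow the word automatically.\<close>

definition cylinder :: "(nat \<Rightarrow> nat) \<Rightarrow> nat \<Rightarrow> real set" where
  "cylinder w m = {x. biter w m x \<in> {0..1}}"

lemma log_slope_pos: "i < n \<Longrightarrow> log_slope i > 0"
  unfolding log_slope_def using abs_branch_slope_gt_1 ln_gt_zero by blast

lemma log_slope_sum_cong:
  "(\<And>k. k < m \<Longrightarrow> w k = w' k) \<Longrightarrow> log_slope_sum w m = log_slope_sum w' m"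
  unfolding log_slope_sum_def by (rule sum.cong) auto

lemma cylinder_cong: "(\<And>k. k < m \<Longrightarrow> w k = w' k) \<Longrightarrow> cylinder w m = cylinder w' m"
  unfolding cylinder_def using branch_iter_cong[of m w w' p q] by auto

lemma abs_prod_branch_slope:
  assumes "\<And>k. k < m \<Longrightarrow> w k < n"
  shows "\<bar>\<Prod>k<m. p (w k)\<bar> = exp (log_slope_sum w m)"
proof -
  have "exp (log_slope_sum w m) = (\<Prod>k<m. exp (log_slope (w k)))"
    unfolding log_slope_sum_def by (simp add: exp_sum)
  also have "\<dots> = (\<Prod>k<m. \<bar>p (w k)\<bar>)"
  proof (rule prod.cong)
    fix k assume "k \<in> {..<m}"
    then have "\<bar>p (w k)\<bar> > 1" using assms abs_branch_slope_gt_1 by simp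
    then show "exp (log_slope (w k)) = \<bar>p (w k)\<bar>" unfolding log_slope_def by simp
  qed simp
  finally show ?thesis by (simp add: abs_prod)
qed

lemma cylinder_interval:
  assumes "\<And>k. k < m \<Longrightarrow> w k < n"
  obtains u v where "v - u = exp (- log_slope_sum w m)" "cylinder w m = {u..v}"
    "{x. biter w m x \<in> {0<..<1}} = {u<..<v}"
proof -
  define c where "c = (\<Prod>k<m. p (w k))"
  define d where "d = biter w m 0"
  have it: "biter w m x = d + c * x" for x
    unfolding c_def d_def by (rule branch_iter_affine)
  have abs_c: "\<bar>c\<bar> = exp (log_slope_sum w m)"
    unfolding c_def using abs_prod_branch_slope[OF assms] .
  then have "c \<noteq> 0" by auto
  then consider "c > 0" | "c < 0" by linarith
  then show ?thesis
  proof cases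
    case 1
    show ?thesis
    proof (rule that[of "(1 - d)/c" "- d/c"])
      show "(1 - d) / c - - d / c = exp (- log_slope_sum w m)"
        using 1 abs_c by (simp add: exp_minus field_simps)
    qed (use 1 in \<open>auto simp: cylinder_def it field_simps\<close>)
  next
    case 2
    show ?thesis
    proof (rule that[of "- d/c" "(1 - d)/c"])
      show "- d / c - (1 - d) / c = exp (- log_slope_sum w m)"
        using 2 abs_c by (simp add: exp_minus field_simps)
    qed (use 2 in \<open>auto simp: cylinder_def it field_simps\<close>)
  qed
qed

lemma cylinder_diameter:
  assumes "\<And>k. k < m \<Longrightarrow> w k < n"
  shows "bounded (cylinder w m)" "diameter (cylinder w m) = exp (- log_slope_sum w m)"
proof -
  obtain u v where uv: "v - u = exp (- log_slope_sum w m)" "cylinder w m = {u..v}"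
    "{x. biter w m x \<in> {0<..<1}} = {u<..<v}"
    by (rule cylinder_interval[OF assms])
  then have "u \<le> v" by (metis diff_ge_0_iff_ge exp_ge_zero)
  with uv show "bounded (cylinder w m)" "diameter (cylinder w m) = exp (- log_slope_sum w m)"
    by (auto simp: diameter_closed_interval)
qed

lemma biter_mem_antimono:
  assumes "\<And>k. k < m \<Longrightarrow> w k < n" "biter w m x \<in> {0..1}" "j \<le> m"
  shows "biter w j x \<in> {0..1}"
  using assms(3,2,1)
proof (induction m rule: dec_induct)
  case (step m)
  then have "biter w m x \<in> {a (w m)..b (w m)}"
    using branch_mem_iff[of "w m" "biter w m x"] by simp
  then have "biter w m x \<in> {0..1}" using branch_bounds[of "w m"] step.prems(2) by force
  with step show ?case by simp
qed simp

lemma biter_mem_branch: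
  assumes "\<And>k. k < m \<Longrightarrow> w k < n" "biter w m x \<in> {0..1}" "j < m"
  shows "biter w j x \<in> {a (w j)..b (w j)}"
  using biter_mem_antimono[OF assms(1,2), of "Suc j"] branch_mem_iff[of "w j"] assms(1,3) by simp

lemma biter_mem_open_antimono:
  assumes "\<And>k. k < m \<Longrightarrow> w k < n" "biter w m x \<in> {0<..<1}" "j \<le> m"
  shows "biter w j x \<in> {0<..<1}"
  using assms(3,2,1)
proof (induction m rule: dec_induct)
  case (step m)
  then have "biter w m x \<in> {a (w m)<..<b (w m)}"
    using branch_mem_open_iff[of "w m" "biter w m x"] by simp
  then have "biter w m x \<in> {0<..<1}" using branch_bounds[of "w m"] step.prems(2) by force
  with step show ?case by simp
qed simp

lemma biter_mem_open_branch:
  assumes "\<And>k. k < m \<Longrightarrow> w k < n" "biter w m x \<in> {0<..<1}" "j < m"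
  shows "biter w j x \<in> {a (w j)<..<b (w j)}"
  using biter_mem_open_antimono[OF assms(1,2), of "Suc j"] branch_mem_open_iff[of "w j"] assms(1,3)
  by simp

text \<open>If the words agree before position k, the k-th iterates coincide, and this common point
  lies in the open interval of both k-th branches; disjointness forces equal letters.\<close>

lemma open_cylinders_same_word:
  assumes "\<And>k. k < m \<Longrightarrow> w k < n" "\<And>k. k < m \<Longrightarrow> w' k < n"
    and "biter w m x \<in> {0<..<1}" "biter w' m x \<in> {0<..<1}" "k < m"
  shows "w k = w' k"
  using assms(5)
proof (induction k rule: less_induct)
  case (less k)
  then have "biter w k x = biter w' k x" by (intro branch_iter_cong) auto
  moreover have "biter w k x \<in> {a (w k)<..<b (w k)}" "biter w' k x \<in> {a (w' k)<..<b (w' k)}"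
    using biter_mem_open_branch assms less.prems by blast+
  ultimately show ?case using branch_disjoint[of "w k" "w' k"] assms(1,2) less.prems by fastforce
qed

text \<open>Each of these cylinders contains an open interval of length r near U. Distinct words
  give disjoint open intervals, and all of them fit into a window of length 4 r.\<close>

lemma card_cylinders_meeting_le:
  assumes W: "W \<subseteq> PiE {..<m} (\<lambda>_. {..<n})" and r: "0 < r"
    and long: "\<And>w. w \<in> W \<Longrightarrow> r \<le> exp (- log_slope_sum w m)"
    and meet: "\<And>w. w \<in> W \<Longrightarrow> cylinder w m \<inter> U \<noteq> {}"
    and U: "bounded U" "diameter U \<le> r"
  shows "card W \<le> 4"
proof (cases "W = {}")
  case False
  have fin: "finite W" using W finite_PiE[of "{..<m}" "\<lambda>_. {..<n}"] finite_subset by blast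
  have wn: "w k < n" if "w \<in> W" "k < m" for w k using W that by blast
  obtain x0 where x0: "x0 \<in> U" using meet False by blast
  have "\<exists>c. {c<..<c+r} \<subseteq> {x. biter w m x \<in> {0<..<1}} \<and> {c<..<c+r} \<subseteq> {x0 - 2*r..x0 + 2*r}"
    if w: "w \<in> W" for w
  proof -
    obtain u v where uv: "v - u = exp (- log_slope_sum w m)" "cylinder w m = {u..v}"
        "{x. biter w m x \<in> {0<..<1}} = {u<..<v}"
      by (rule cylinder_interval[OF wn[OF w]])
    obtain x where x: "x \<in> cylinder w m" "x \<in> U" using meet[OF w] by blast
    have "dist x x0 \<le> r" using diameter_bounded_bound[OF U(1) x(2) x0] U(2) by simp
    moreover have "r \<le> v - u" using long[OF w] uv(1) by simp
    \<comment> \<open>The interval of length r starting at \<open>max u (x - r)\<close> ends at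
      \<open>max (u + r) x\<close>, hence stays inside the cylinder and within r of x, which is
      itself within r of \<open>x0\<close>.\<close>
    ultimately show ?thesis unfolding uv(3) using x(1)[unfolded uv(2)]
      by (intro exI[of _ "max u (x - r)"]) (auto simp: dist_real_def)
  qed
  then obtain c where c: "\<And>w. w \<in> W \<Longrightarrow> {c w<..<c w+r} \<subseteq> {x. biter w m x \<in> {0<..<1}}"
      "\<And>w. w \<in> W \<Longrightarrow> {c w<..<c w+r} \<subseteq> {x0 - 2*r..x0 + 2*r}"
    by metis
  have disj: "disjoint_family_on (\<lambda>w. {c w<..<c w+r}) W"
    unfolding disjoint_family_on_def
  proof (intro ballI impI, rule ccontr)
    fix w w' assume w: "w \<in> W" "w' \<in> W" "w \<noteq> w'" "{c w<..<c w+r} \<inter> {c w'<..<c w'+r} \<noteq> {}"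
    then obtain x where "biter w m x \<in> {0<..<1}" "biter w' m x \<in> {0<..<1}"
      using c(1)[of w] c(1)[of w'] by blast
    then have "w k = w' k" if "k < m" for k
      using open_cylinders_same_word[of m w w' x k] wn w(1,2) that by blast
    then have "w = w'" using W w(1,2) by (intro PiE_ext[of w "{..<m}" "\<lambda>_. {..<n}"]) auto
    with w(3) show False by simp
  qed
  have "real (card W) * r = (\<Sum>w\<in>W. measure lborel {c w<..<c w+r})"
    using r by simp
  also have "\<dots> = measure lborel (\<Union>w\<in>W. {c w<..<c w+r})"
    by (rule measure_finite_Union[symmetric]) (use fin disj r in auto)
  also have "\<dots> \<le> measure lborel {x0 - 2*r..x0 + 2*r}"
    using c(2) by (intro measure_mono_fmeasurable) (auto intro!: sets.finite_UN fin fmeasurableI simp: emeasure_lborel_Icc_eq)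
  also have "\<dots> = 4 * r" using r by simp
  finally have "real (card W) \<le> 4" using r by simp
  then show ?thesis by simp
qed simp

text \<open>The cylinders of the prefixes of w are nested nonempty compact intervals.\<close>

lemma exists_point_with_itinerary:
  assumes "\<And>k. w k < n"
  obtains x where "\<And>m. biter w m x \<in> {0..1}"
proof -
  have "\<exists>x. \<forall>m. x \<in> cylinder w m"
  proof (rule ccontr)
    assume "\<nexists>x. \<forall>m. x \<in> cylinder w m"
    then have "\<Inter>(range (cylinder w)) = {}" by blast
    moreover have "\<Inter>(range (cylinder w)) \<noteq> {}"
    proof (rule compact_nest)
      fix m
      obtain u v where uv: "v - u = exp (- log_slope_sum w m)" "cylinder w m = {u..v}"
          "{x. biter w m x \<in> {0<..<1}} = {u<..<v}"
        by (rule cylinder_interval[OF assms])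
      then have "u \<le> v" by (metis diff_ge_0_iff_ge exp_ge_zero)
      with uv(2) show "compact (cylinder w m)" "cylinder w m \<noteq> {}" by simp_all
    next
      fix j m :: nat assume "j \<le> m"
      then show "cylinder w m \<subseteq> cylinder w j"
        unfolding cylinder_def using biter_mem_antimono assms by blast
    qed
    ultimately show False by simp
  qed
  then show ?thesis using that unfolding cylinder_def by blast
qed

text \<open>Some itinerary with the right mean is required, since a boundary point may admit
  several.\<close>

definition coded_level_set :: "real \<Rightarrow> real set" where
  "coded_level_set \<alpha> = {x. \<exists>w. (\<forall>k. w k < n) \<and> (\<forall>m. biter w m x \<in> {0..1}) \<and>
     (\<lambda>m. log_slope_sum w m / real m) \<longlonglongrightarrow> \<alpha>}"

text \<open>Off this set an orbit that stays in the branches runs through open branch intervals, so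
  the itinerary is forced and every iterate of the map is affine near the point.\<close>

definition endpoint_preimages :: "real set" where
  "endpoint_preimages =
     {x. \<exists>m w. (\<forall>k<m. w k < n) \<and> biter w m x \<in> a ` {..<n} \<union> b ` {..<n}}"

text \<open>There are countably many finite words, and each gives an injective affine map, under
  which the finitely many endpoints have finitely many preimages.\<close>

lemma countable_endpoint_preimages: "countable endpoint_preimages"
proof -
  have "endpoint_preimages \<subseteq>
      (\<Union>m. \<Union>w\<in>PiE {..<m} (\<lambda>_. {..<n}). biter w m -` (a ` {..<n} \<union> b ` {..<n}))"
  proof
    fix x assume "x \<in> endpoint_preimages"
    then obtain m w where w: "\<And>k. k < m \<Longrightarrow> w k < n" "biter w m x \<in> a ` {..<n} \<union> b ` {..<n}"
      unfolding endpoint_preimages_def by blast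
    have "biter (restrict w {..<m}) m x = biter w m x" by (rule branch_iter_cong) simp
    moreover have "restrict w {..<m} \<in> PiE {..<m} (\<lambda>_. {..<n})" using w(1) by auto
    ultimately show "x \<in> (\<Union>m. \<Union>w\<in>PiE {..<m} (\<lambda>_. {..<n}). biter w m -` (a ` {..<n} \<union> b ` {..<n}))"
      using w(2) by (intro UN_I[of m] UN_I[of "restrict w {..<m}"]) auto
  qed
  moreover have fin: "finite (biter w m -` (a ` {..<n} \<union> b ` {..<n}))"
    if "w \<in> PiE {..<m} (\<lambda>_. {..<n})" for m w
  proof (rule finite_vimageI)
    have "\<bar>\<Prod>k<m. p (w k)\<bar> = exp (log_slope_sum w m)"
      using abs_prod_branch_slope[of m w] that by blast
    then have "(\<Prod>k<m. p (w k)) \<noteq> 0" by (metis abs_zero exp_not_eq_zero)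
    then show "inj (biter w m)"
      by (intro injI) (metis branch_iter_affine add_left_cancel mult_left_cancel)
  qed simp
  have "countable (\<Union>m. \<Union>w\<in>PiE {..<m} (\<lambda>_. {..<n}). biter w m -` (a ` {..<n} \<union> b ` {..<n}))"
    by (rule countable_UN, simp, rule countable_UN, rule countable_finite, rule finite_PiE)
      (simp_all only: finite_lessThan countable_finite[OF fin])
  ultimately show ?thesis using countable_subset by blast
qed

end

section \<open>Passage from the map to its itineraries\<close>

locale pl_map = pl_branches +
  fixes T :: "real \<Rightarrow> real"
  assumes T_branch: "\<And>x. x \<in> pl_domain n a b \<Longrightarrow> \<exists>i<n. x \<in> {a i..b i} \<and> T x = p i * x + q i"
begin

text \<open>A second branch containing x would overlap branch i in a nondegenerate open interval,
  because x is interior to one of two nondegenerate intervals.\<close>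

lemma T_eq_branch:
  assumes "i < n" "x \<in> {a i<..<b i}"
  shows "T x = p i * x + q i"
proof -
  have "x \<in> pl_domain n a b" unfolding pl_domain_def using assms by force
  then obtain j where j: "j < n" "x \<in> {a j..b j}" "T x = p j * x + q j" using T_branch by blast
  have "j = i"
  proof (rule ccontr)
    assume "j \<noteq> i"
    define l where "l = max (a i) (a j)"
    define r where "r = min (b i) (b j)"
    have "l < r" using assms(2) j branch_bounds[of i] branch_bounds[of j] assms(1)
      by (auto simp: l_def r_def)
    then have "(l + r)/2 \<in> {a i<..<b i} \<inter> {a j<..<b j}" by (auto simp: l_def r_def)
    then show False using branch_disjoint[OF assms(1) j(1)] \<open>j \<noteq> i\<close> by blast
  qed
  with j show ?thesis by simp
qed

context
  fixes x w
  assumes x: "x \<notin> endpoint_preimages" and w: "\<And>k. w k < n" and orbit: "\<And>m. biter w m x \<in> {0..1}"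
begin

lemma eventually_biter_mem_branch: "\<forall>\<^sub>F y in nhds x. biter w m y \<in> {a (w m)<..<b (w m)}"
proof -
  have "biter w m x \<in> {a (w m)..b (w m)}"
    using biter_mem_branch[of "Suc m" w x m] w orbit[of "Suc m"] by blast
  moreover have "biter w m x \<noteq> a (w m)" "biter w m x \<noteq> b (w m)"
    using x w unfolding endpoint_preimages_def by blast+
  ultimately have "biter w m x \<in> {a (w m)<..<b (w m)}" by auto
  moreover have "continuous_on UNIV (biter w m)"
    by (subst branch_iter_affine[abs_def]) (intro continuous_intros)
  then have "open (biter w m -` {a (w m)<..<b (w m)})"
    by (intro open_vimage) auto
  ultimately show ?thesis unfolding eventually_nhds by blast
qed

lemma eventually_funpow_eq_biter: "\<forall>\<^sub>F y in nhds x. (T ^^ m) y = biter w m y"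
proof (induction m)
  case (Suc m)
  from Suc eventually_biter_mem_branch[of m] show ?case
    by eventually_elim (simp add: T_eq_branch[OF w])
qed simp

lemma funpow_eq_biter: "(T ^^ m) x = biter w m x"
  using eventually_funpow_eq_biter eventually_nhds_x_imp_x by blast

lemma mem_repeller: "x \<in> repeller (pl_domain n a b) T"
  unfolding repeller_def pl_domain_def
  using eventually_nhds_x_imp_x[OF eventually_biter_mem_branch] w
  by (auto simp: funpow_eq_biter intro!: bexI[of _ "w _"] less_imp_le)

text \<open>A whole neighbourhood of x follows the same word for m steps, so the derivative within
  the domain of the iterate is an ordinary two-sided one.\<close>

lemma at_within_iterate_domain: "at x within iterate_domain (pl_domain n a b) T m = at x"
proof -
  have "\<forall>\<^sub>F y in nhds x. \<forall>k\<in>{..<m}. (T ^^ k) y \<in> pl_domain n a b"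
  proof (rule eventually_ball_finite)
    show "\<forall>k\<in>{..<m}. \<forall>\<^sub>F y in nhds x. (T ^^ k) y \<in> pl_domain n a b"
    proof
      fix k
      from eventually_funpow_eq_biter[of k] eventually_biter_mem_branch[of k]
      show "\<forall>\<^sub>F y in nhds x. (T ^^ k) y \<in> pl_domain n a b"
        by eventually_elim (use w[of k] in \<open>force simp: pl_domain_def\<close>)
    qed
  qed simp
  then obtain S where "open S" "x \<in> S" "S \<subseteq> iterate_domain (pl_domain n a b) T m"
    unfolding eventually_nhds iterate_domain_def by blast
  then have "x \<in> interior (iterate_domain (pl_domain n a b) T m)" by (meson interiorI)
  then show ?thesis by (rule at_within_interior)
qed

lemma funpow_has_derivative: "((T ^^ m) has_real_derivative (\<Prod>k<m. p (w k))) (at x)"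
proof -
  have "(biter w m has_real_derivative (\<Prod>k<m. p (w k))) (at x)"
    by (subst branch_iter_affine[abs_def]) (auto intro!: derivative_eq_intros)
  then show ?thesis using DERIV_cong_ev[OF refl eventually_funpow_eq_biter refl] by blast
qed

lemma has_lyapunov_exponent_iff:
  "has_lyapunov_exponent (pl_domain n a b) T x \<alpha> \<longleftrightarrow>
    (\<lambda>m. log_slope_sum w m / real m) \<longlonglongrightarrow> \<alpha>"
proof -
  have "ln \<bar>\<Prod>k<m. p (w k)\<bar> = log_slope_sum w m" for m
    using abs_prod_branch_slope[of m w] w by simp
  moreover have "((T ^^ m) has_real_derivative d) (at x) \<longleftrightarrow> d = (\<Prod>k<m. p (w k))" for d m
    using funpow_has_derivative DERIV_unique by blast
  ultimately show ?thesis
    unfolding has_lyapunov_exponent_def at_within_iterate_domain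
    by (auto simp: fun_eq_iff[symmetric])
qed

end

abbreviation level_set :: "real \<Rightarrow> real set" where
  "level_set \<alpha> \<equiv> {x \<in> repeller (pl_domain n a b) T.
     has_lyapunov_exponent (pl_domain n a b) T x \<alpha>}"

lemma repeller_itinerary:
  assumes "x \<in> repeller (pl_domain n a b) T"
  obtains w where "\<And>k. w k < n" "\<And>m. biter w m x \<in> {0..1}"
proof -
  have dom: "(T ^^ m) x \<in> pl_domain n a b" for m using assms unfolding repeller_def by auto
  then have "\<forall>m. \<exists>i<n. (T ^^ m) x \<in> {a i..b i} \<and> T ((T ^^ m) x) = p i * (T ^^ m) x + q i"
    using T_branch by blast
  then obtain w where w: "\<And>m. w m < n" "\<And>m. (T ^^ m) x \<in> {a (w m)..b (w m)}"
      "\<And>m. T ((T ^^ m) x) = p (w m) * (T ^^ m) x + q (w m)"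
    by metis
  have "biter w m x = (T ^^ m) x" for m
    by (induction m) (auto simp: w(3))
  moreover have "(T ^^ m) x \<in> {0..1}" for m
    using w(2)[of m] branch_bounds[OF w(1)[of m]] by auto
  ultimately show ?thesis using that w(1) by metis
qed

lemma level_set_eq_coded_level_set:
  "level_set \<alpha> - endpoint_preimages = coded_level_set \<alpha> - endpoint_preimages"
proof (intro set_eqI iffI)
  fix x assume x: "x \<in> level_set \<alpha> - endpoint_preimages"
  then obtain w where "\<And>k. w k < n" "\<And>m. biter w m x \<in> {0..1}"
    using repeller_itinerary by blast
  then show "x \<in> coded_level_set \<alpha> - endpoint_preimages"
    using x has_lyapunov_exponent_iff[of x w \<alpha>] unfolding coded_level_set_def by blast
next
  fix x assume x: "x \<in> coded_level_set \<alpha> - endpoint_preimages"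
  then obtain w where "\<And>k. w k < n" "\<And>m. biter w m x \<in> {0..1}"
      "(\<lambda>m. log_slope_sum w m / real m) \<longlonglongrightarrow> \<alpha>"
    unfolding coded_level_set_def by blast
  then show "x \<in> level_set \<alpha> - endpoint_preimages"
    using x has_lyapunov_exponent_iff[of x w \<alpha>] mem_repeller[of x w] by blast
qed

lemma level_set_null_iff:
  assumes "s > 0"
  shows "hausdorff_measure s (level_set \<alpha>) = 0 \<longleftrightarrow> hausdorff_measure s (coded_level_set \<alpha>) = 0"
proof -
  have null: "hausdorff_measure s endpoint_preimages = 0"
    using countable_endpoint_preimages assms by (rule hausdorff_measure_countable_eq_0)
  have "hausdorff_measure s B = 0"
    if "hausdorff_measure s A = 0" "A - endpoint_preimages = B - endpoint_preimages" for A B :: "real set"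
    by (rule hausdorff_measure_eq_0_mono[OF hausdorff_measure_Un_eq_0[OF that(1) null]])
      (use that(2) in blast)
  then show ?thesis using level_set_eq_coded_level_set by metis
qed

end

section \<open>The dimension of level sets\<close>

lemma indep_vars_PiM_coordinates:
  fixes P :: "'a pmf" and I :: "'i set"
  assumes "I \<noteq> {}"
  shows "prob_space.indep_vars (PiM I (\<lambda>_. measure_pmf P)) (\<lambda>_. measure_pmf P) (\<lambda>k w. w k) I"
proof -
  interpret product_prob_space "\<lambda>_. measure_pmf P" I by unfold_locales
  \<comment> \<open>Collecting all coordinates gives the identity on the product space, so the joint
    law is the product measure, which is the product of the marginal laws.\<close>
  have "distr (PiM I (\<lambda>_. measure_pmf P)) (PiM I (\<lambda>_. measure_pmf P)) (\<lambda>w. \<lambda>i\<in>I. w i)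
      = distr (PiM I (\<lambda>_. measure_pmf P)) (PiM I (\<lambda>_. measure_pmf P)) (\<lambda>w. w)"
    by (rule distr_cong) (auto simp: space_PiM PiE_def extensional_restrict)
  also have "\<dots> = PiM I (\<lambda>i. distr (PiM I (\<lambda>_. measure_pmf P)) (measure_pmf P) (\<lambda>w. w i))"
    unfolding distr_id by (intro PiM_cong) (simp_all add: PiM_component)
  finally show ?thesis
    using assms by (subst indep_vars_iff_distr_eq_PiM') auto
qed

text \<open>Hoeffding's inequality bounds the probability of a deviation by e from the mean
  geometrically in m. Borel-Cantelli then makes such deviations finitely frequent almost surely, and
  the countably many values e = 1/(j+1) yield convergence.\<close>

lemma strong_law_PiM_bounded:
  fixes P :: "'a pmf" and f :: "'a \<Rightarrow> real"
  assumes bound: "\<And>i. i \<in> set_pmf P \<Longrightarrow> \<bar>f i\<bar> \<le> B"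
  shows "AE w in PiM (UNIV :: nat set) (\<lambda>_. measure_pmf P).
    (\<lambda>m. (\<Sum>k<m. f (w k)) / real m) \<longlonglongrightarrow> measure_pmf.expectation P f"
proof -
  interpret product_prob_space "\<lambda>_. measure_pmf P" "UNIV :: nat set" by unfold_locales
  define M where "M = PiM (UNIV :: nat set) (\<lambda>_. measure_pmf P)"
  interpret pM: prob_space M unfolding M_def by (rule P.prob_space_axioms)
  define \<mu> where "\<mu> = measure_pmf.expectation P f"
  \<comment> \<open>The added 1 keeps the range [-c, c] nondegenerate, so Hoeffding's denominator is
    positive for m > 0 even when B = 0.\<close>
  define c where "c = \<bar>B\<bar> + 1"
  have c: "c > 0" "\<And>i. i \<in> set_pmf P \<Longrightarrow> f i \<in> {-c..c}"
    using bound by (auto simp: c_def abs_le_iff) force+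
  have [measurable]: "(\<lambda>w. f (w k)) \<in> borel_measurable M" for k
    unfolding M_def by (rule measurable_compose[OF measurable_component_singleton]) auto
  have indep: "pM.indep_vars (\<lambda>_. borel) (\<lambda>k w. f (w k)) UNIV"
    using indep_vars_PiM_coordinates[of "UNIV :: nat set" P] unfolding M_def
    by (rule P.indep_vars_compose2) auto
  have exp: "pM.expectation (\<lambda>w. f (w k)) = \<mu>" for k
  proof -
    have "\<mu> = integral\<^sup>L (distr M (measure_pmf P) (\<lambda>w. w k)) f"
      unfolding M_def \<mu>_def using PiM_component[of k] by simp
    also have "\<dots> = pM.expectation (\<lambda>w. f (w k))"
      unfolding M_def by (rule integral_distr) auto
    finally show ?thesis by simp
  qed
  have range: "AE w in M. f (w k) \<in> {-c..c}" for k
    unfolding M_def by (rule AE_component) (auto simp: AE_measure_pmf_iff intro: c(2) simp del: atLeastAtMost_iff)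
  have AE_ev: "AE w in M. \<forall>\<^sub>F m in sequentially. \<bar>(\<Sum>k<m. f (w k)) - real m * \<mu>\<bar> < real m * e"
    if "e > 0" for e
  proof -
    define A where "A m = {w \<in> space M. \<bar>(\<Sum>k<m. f (w k)) - real m * \<mu>\<bar> \<ge> real m * e}" for m
    have tail: "measure M (A m) \<le> 2 * exp (- (e\<^sup>2 / (2 * c\<^sup>2)) * real m)" for m
    proof (cases "m = 0")
      case True
      then show ?thesis by (simp add: order_trans[OF pM.prob_le_1])
    next
      case False
      interpret H: Hoeffding_ineq M "{..<m}" "\<lambda>k w. f (w k)" "\<lambda>_. -c" "\<lambda>_. c"
          "\<Sum>k<m. pM.expectation (\<lambda>w. f (w k))"
      proof (unfold_locales, goal_cases)
        case 2 then show ?case by (rule pM.indep_vars_subset[OF indep]) auto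
      qed (use range in \<open>auto\<close>)
      have "measure M (A m) \<le> 2 * exp (-2 * (real m * e)\<^sup>2 / (\<Sum>i<m. (c - - c)\<^sup>2))"
        using H.Hoeffding_ineq_abs_ge[of "real m * e"] that c(1) False
        unfolding A_def by (simp add: exp)
      also have "-2 * (real m * e)\<^sup>2 / (\<Sum>i<m. (c - - c)\<^sup>2) = - (e\<^sup>2 / (2 * c\<^sup>2)) * real m"
        using False c(1) by (simp add: power2_eq_square field_simps)
      finally show ?thesis .
    qed
    have "summable (\<lambda>m. 2 * exp (- (e\<^sup>2 / (2 * c\<^sup>2))) ^ m)"
      using that c(1) by (intro summable_mult summable_geometric) simp
    moreover have "exp (- (e\<^sup>2 / (2 * c\<^sup>2))) ^ m = exp (- (e\<^sup>2 / (2 * c\<^sup>2)) * real m)" for m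
      by (simp add: exp_of_nat_mult[symmetric] mult.commute)
    ultimately have "summable (\<lambda>m. measure M (A m))"
      using tail by (intro summable_comparison_test[of "\<lambda>m. measure M (A m)"
        "\<lambda>m. 2 * exp (- (e\<^sup>2 / (2 * c\<^sup>2))) ^ m"]) (simp_all only: real_norm_def abs_of_nonneg measure_nonneg, blast)
    then have "AE w in M. \<forall>\<^sub>F m in sequentially. w \<in> space M - A m"
      by (intro borel_cantelli_AE1) (auto simp: A_def pM.emeasure_eq_measure)
    then show ?thesis
      by (rule AE_mp) (auto simp: A_def not_le elim!: eventually_mono)
  qed
  have "AE w in M. \<forall>j. \<forall>\<^sub>F m in sequentially.
      \<bar>(\<Sum>k<m. f (w k)) - real m * \<mu>\<bar> < real m * (1 / real (Suc j))"
    unfolding AE_all_countable by (intro allI AE_ev) simp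
  then have "AE w in M. (\<lambda>m. (\<Sum>k<m. f (w k)) / real m) \<longlonglongrightarrow> \<mu>"
  proof (rule AE_mp, intro AE_I2 impI)
    fix w assume *: "\<forall>j. \<forall>\<^sub>F m in sequentially.
      \<bar>(\<Sum>k<m. f (w k)) - real m * \<mu>\<bar> < real m * (1 / real (Suc j))"
    show "(\<lambda>m. (\<Sum>k<m. f (w k)) / real m) \<longlonglongrightarrow> \<mu>"
    proof (rule tendstoI)
      fix e :: real assume "e > 0"
      then obtain j where j: "1 / real (Suc j) < e" using nat_approx_posE by blast
      from *[rule_format, of j] eventually_gt_at_top[of 0]
      show "\<forall>\<^sub>F m in sequentially. dist ((\<Sum>k<m. f (w k)) / real m) \<mu> < e"
      proof eventually_elim
        case (elim m)
        have "dist ((\<Sum>k<m. f (w k)) / real m) \<mu> = \<bar>((\<Sum>k<m. f (w k)) - real m * \<mu>) / real m\<bar>"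
          using elim(2) by (simp add: dist_real_def diff_divide_distrib)
        also have "\<dots> = \<bar>(\<Sum>k<m. f (w k)) - real m * \<mu>\<bar> / real m"
          by (simp add: abs_divide)
        also have "\<dots> < 1 / real (Suc j)"
          using elim by (simp add: pos_divide_less_eq mult.commute)
        finally show ?case using j by simp
      qed
    qed
  qed
  then show ?thesis unfolding M_def \<mu>_def .
qed

section \<open>Upper bound for the dimension by covers with cylinders\<close>

context pl_branches
begin

definition partition_sum :: "real \<Rightarrow> real" where
  "partition_sum t = (\<Sum>i<n. exp (t * log_slope i))"

lemma partition_sum_pos: "partition_sum t > 0"
  unfolding partition_sum_def using n_pos by (intro sum_pos) auto

lemma sum_words_exp_log_slope_sum:
  "(\<Sum>w\<in>PiE {..<m} (\<lambda>_. {..<n}). exp (t * log_slope_sum w m)) = partition_sum t ^ m"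
proof -
  have "partition_sum t ^ m = (\<Prod>k<m. \<Sum>i<n. exp (t * log_slope i))"
    by (simp add: partition_sum_def)
  also have "\<dots> = (\<Sum>w\<in>PiE {..<m} (\<lambda>_. {..<n}). \<Prod>k<m. exp (t * log_slope (w k)))"
    by (rule prod_sum_PiE) auto
  finally show ?thesis
    by (simp add: log_slope_sum_def sum_distrib_left exp_sum)
qed

lemma log_slope_uniform_lower_bound:
  obtains l where "l > 0" "\<And>i. i < n \<Longrightarrow> l \<le> log_slope i"
proof -
  have "Min (log_slope ` {..<n}) > 0" using log_slope_pos n_pos by (subst Min_gr_iff) auto
  then show ?thesis by (intro that[of "Min (log_slope ` {..<n})"]) auto
qed

text \<open>The product form also holds at m = 0, where the quotient is 0 by convention and carries
  no information.\<close>

lemma deviation_le: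
  assumes "\<bar>log_slope_sum w m / real m - \<alpha>\<bar> < \<epsilon>"
  shows "\<bar>log_slope_sum w m - real m * \<alpha>\<bar> \<le> real m * \<epsilon>"
proof (cases "m = 0")
  case False
  have "\<bar>log_slope_sum w m - real m * \<alpha>\<bar> = real m * \<bar>log_slope_sum w m / real m - \<alpha>\<bar>"
    using False abs_mult[of "real m" "log_slope_sum w m / real m - \<alpha>"]
    by (simp add: right_diff_distrib)
  then show ?thesis using assms by (simp add: mult_left_mono)
qed (simp add: log_slope_sum_def)

text \<open>Let S be the log-slope sum of a word of length m with S close to m \<alpha>. Its
  cylinder costs exp(-s S), which is at most exp(t S) exp(-(P + \<eta>) m). Summing exp(t S) over
  all words gives exp(P m), so the cover costs at most exp(-\<eta> m). Every t yields such a
  bound.\<close>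

lemma coded_level_set_null:
  assumes "ln (partition_sum t) < (s + t) * \<alpha>" "s > 0"
  shows "hausdorff_measure s (coded_level_set \<alpha>) = 0"
proof -
  define P where "P = ln (partition_sum t)"
  \<comment> \<open>Half of the available gap absorbs the deviation of the word means from \<alpha>;
    the other half remains as the exponential decay rate.\<close>
  define \<eta> where "\<eta> = ((s + t) * \<alpha> - P) / 2"
  \<comment> \<open>The added 1 keeps the quotient meaningful when s + t = 0.\<close>
  define \<epsilon> where "\<epsilon> = \<eta> / (\<bar>s + t\<bar> + 1)"
  have \<eta>: "\<eta> > 0" using assms(1) by (simp add: \<eta>_def P_def)
  then have \<epsilon>: "\<epsilon> > 0" by (simp add: \<epsilon>_def add_nonneg_pos)
  have \<epsilon>\<eta>: "\<bar>s + t\<bar> * \<epsilon> \<le> \<eta>"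
    using \<eta> by (simp add: \<epsilon>_def field_simps)
  \<comment> \<open>Convergence of the means is not uniform over the level set; on each of these
    countably many pieces the deviation bound holds from a fixed N on.\<close>
  define A where "A N = {x. \<exists>w. (\<forall>k. w k < n) \<and> (\<forall>m. biter w m x \<in> {0..1}) \<and>
     (\<forall>m\<ge>N. \<bar>log_slope_sum w m - real m * \<alpha>\<bar> \<le> real m * \<epsilon>)}" for N
  have "coded_level_set \<alpha> \<subseteq> (\<Union>N. A N)"
  proof
    fix x assume "x \<in> coded_level_set \<alpha>"
    then obtain w where w: "\<forall>k. w k < n" "\<forall>m. biter w m x \<in> {0..1}"
        "(\<lambda>m. log_slope_sum w m / real m) \<longlonglongrightarrow> \<alpha>"
      unfolding coded_level_set_def by blast
    obtain N where N: "\<And>m. m \<ge> N \<Longrightarrow> \<bar>log_slope_sum w m / real m - \<alpha>\<bar> < \<epsilon>"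
      using LIMSEQ_D[OF w(3) \<epsilon>] by auto
    have "\<bar>log_slope_sum w m - real m * \<alpha>\<bar> \<le> real m * \<epsilon>" if "m \<ge> N" for m
      using deviation_le[OF N[OF that]] .
    then show "x \<in> (\<Union>N. A N)" using w unfolding A_def by blast
  qed
  moreover have "hausdorff_measure s (A N) = 0" for N
    unfolding hausdorff_measure_eq_0_iff
  proof (intro allI impI)
    fix \<delta> e :: real assume "\<delta> > 0" "e > 0"
    obtain l where l: "l > 0" "\<And>i. i < n \<Longrightarrow> l \<le> log_slope i"
      using log_slope_uniform_lower_bound by blast
    have lim: "(\<lambda>m. exp (- c * real m)) \<longlonglongrightarrow> 0" if "c > 0" for c
      using LIMSEQ_power_zero[of "exp (-c)"] that
      by (simp add: exp_of_nat_mult[symmetric] mult.commute)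
    have "\<forall>\<^sub>F m in sequentially. exp (- l * real m) < \<delta> \<and> exp (- \<eta> * real m) < e \<and> m \<ge> N"
      using order_tendstoD(2)[OF lim[OF l(1)] \<open>\<delta> > 0\<close>] order_tendstoD(2)[OF lim[OF \<eta>] \<open>e > 0\<close>]
        eventually_ge_at_top[of N] by eventually_elim simp
    then obtain m where m: "exp (- l * real m) < \<delta>" "exp (- \<eta> * real m) < e" "m \<ge> N"
      unfolding eventually_sequentially by blast
    define W where "W = {w \<in> PiE {..<m} (\<lambda>_. {..<n}).
      \<bar>log_slope_sum w m - real m * \<alpha>\<bar> \<le> real m * \<epsilon>}"
    have fin: "finite (PiE {..<m} (\<lambda>_. {..<n}))" by (intro finite_PiE) auto
    then have finW: "finite W" by (simp add: W_def)
    have wn: "w k < n" if "w \<in> PiE {..<m} (\<lambda>_. {..<n})" "k < m" for w k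
      using that by blast
    have cover: "A N \<subseteq> (\<Union>w\<in>W. cylinder w m)"
    proof
      fix x assume "x \<in> A N"
      then obtain w where w: "\<forall>k. w k < n" "biter w m x \<in> {0..1}"
          "\<bar>log_slope_sum w m - real m * \<alpha>\<bar> \<le> real m * \<epsilon>"
        unfolding A_def using m(3) by blast
      have eq: "log_slope_sum (restrict w {..<m}) m = log_slope_sum w m"
          "cylinder (restrict w {..<m}) m = cylinder w m"
        by (rule log_slope_sum_cong cylinder_cong; simp)+
      show "x \<in> (\<Union>w\<in>W. cylinder w m)"
        using w by (intro UN_I[of "restrict w {..<m}"]) (auto simp: W_def eq, simp add: cylinder_def)
    qed
    have small: "bounded (cylinder w m) \<and> diameter (cylinder w m) \<le> \<delta>" if "w \<in> W" for w
    proof -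
      have w: "w \<in> PiE {..<m} (\<lambda>_. {..<n})" using that by (simp add: W_def)
      have "l * real m = (\<Sum>k<m. l)" by simp
      also have "\<dots> \<le> log_slope_sum w m"
        unfolding log_slope_sum_def using wn[OF w] l(2) by (intro sum_mono) auto
      finally have "exp (- log_slope_sum w m) \<le> exp (- l * real m)" by simp
      then have "exp (- log_slope_sum w m) \<le> \<delta>" using m(1) by linarith
      then show ?thesis using cylinder_diameter[where w = w and m = m, OF wn[OF w]] by simp
    qed
    obtain V where V: "A N \<subseteq> (\<Union>k. V k)" "\<forall>k::nat. bounded (V k) \<and> diameter (V k) \<le> \<delta>"
        "(\<Sum>k. diam_pow s (V k)) = (\<Sum>w\<in>W. diam_pow s (cylinder w m))"
      using finite_cover_imp_sequence_cover[OF finW cover small] \<open>\<delta> > 0\<close> by (metis less_imp_le)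
    have "(\<Sum>w\<in>W. diam_pow s (cylinder w m)) \<le>
        (\<Sum>w\<in>W. ennreal (exp (t * log_slope_sum w m) * exp (- (P + \<eta>) * real m)))"
    proof (rule sum_mono)
      fix w assume w: "w \<in> W"
      then have wm: "w \<in> PiE {..<m} (\<lambda>_. {..<n})" and dev: "\<bar>log_slope_sum w m - real m * \<alpha>\<bar> \<le> real m * \<epsilon>"
        by (auto simp: W_def)
      have "(s + t) * (real m * \<alpha>) - (s + t) * log_slope_sum w m \<le> \<bar>(s + t) * (log_slope_sum w m - real m * \<alpha>)\<bar>"
        by (simp add: algebra_simps abs_if)
      also have "\<dots> \<le> \<bar>s + t\<bar> * (real m * \<epsilon>)"
        unfolding abs_mult using dev by (intro mult_left_mono) auto
      also have "\<dots> \<le> real m * \<eta>"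
        using mult_left_mono[OF \<epsilon>\<eta>, of "real m"] by (simp add: mult_ac)
      finally have "- s * log_slope_sum w m \<le> t * log_slope_sum w m + (- (P + \<eta>) * real m)"
        by (simp add: \<eta>_def field_simps)
      then have le: "exp (- s * log_slope_sum w m) \<le> exp (t * log_slope_sum w m) * exp (- (P + \<eta>) * real m)"
        by (simp add: exp_add[symmetric])
      have "exp (- log_slope_sum w m) powr s = exp (- s * log_slope_sum w m)"
        by (simp add: powr_def)
      then show "diam_pow s (cylinder w m) \<le>
          ennreal (exp (t * log_slope_sum w m) * exp (- (P + \<eta>) * real m))"
        using cylinder_diameter(2)[where w = w and m = m, OF wn[OF wm]] le assms(2)
        by (auto simp: diam_pow_def intro!: ennreal_leI)
    qed
    also have "\<dots> = ennreal (\<Sum>w\<in>W. exp (t * log_slope_sum w m) * exp (- (P + \<eta>) * real m))"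
      by simp
    also have "\<dots> \<le> ennreal ((\<Sum>w\<in>PiE {..<m} (\<lambda>_. {..<n}). exp (t * log_slope_sum w m)) *
        exp (- (P + \<eta>) * real m))"
      unfolding sum_distrib_right by (intro ennreal_leI sum_mono2) (use fin in \<open>auto simp: W_def\<close>)
    also have "(\<Sum>w\<in>PiE {..<m} (\<lambda>_. {..<n}). exp (t * log_slope_sum w m)) * exp (- (P + \<eta>) * real m)
        = exp (- \<eta> * real m)"
    proof -
      have "partition_sum t ^ m = exp (P * real m)"
        using partition_sum_pos[of t] by (simp add: P_def exp_of_nat2_mult)
      then show ?thesis
        unfolding sum_words_exp_log_slope_sum by (simp add: exp_add[symmetric] algebra_simps)
    qed
    also have "ennreal (exp (- \<eta> * real m)) < ennreal e" using m(2) by (simp add: ennreal_less_iff)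
    finally show "\<exists>U. A N \<subseteq> (\<Union>k. U k) \<and> (\<forall>k::nat. bounded (U k) \<and> diameter (U k) \<le> \<delta>) \<and>
      (\<Sum>k. diam_pow s (U k)) < ennreal e"
      using V by (intro exI[of _ V]) simp
  qed
  ultimately show ?thesis
    by (meson hausdorff_measure_UN_eq_0 hausdorff_measure_eq_0_mono)
qed

section \<open>Gibbs measures and the lower bound for the dimension\<close>

definition pressure :: "real \<Rightarrow> real" where "pressure t = ln (partition_sum t)"

definition gibbs_weight :: "real \<Rightarrow> nat \<Rightarrow> real" where
  "gibbs_weight t i = (if i < n then exp (t * log_slope i) / partition_sum t else 0)"

definition gibbs_pmf :: "real \<Rightarrow> nat pmf" where "gibbs_pmf t = embed_pmf (gibbs_weight t)"

lemma sum_gibbs_weight: "(\<Sum>i<n. gibbs_weight t i) = 1"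
proof -
  have "(\<Sum>i<n. gibbs_weight t i) = partition_sum t / partition_sum t"
    unfolding partition_sum_def[of t] sum_divide_distrib
    by (rule sum.cong) (auto simp: gibbs_weight_def partition_sum_def)
  then show ?thesis using partition_sum_pos[of t] by simp
qed

lemma gibbs_weight_nonneg: "gibbs_weight t i \<ge> 0"
  unfolding gibbs_weight_def using partition_sum_pos[of t] by simp

lemma pmf_gibbs_pmf: "pmf (gibbs_pmf t) i = gibbs_weight t i"
  unfolding gibbs_pmf_def
proof (rule pmf_embed_pmf)
  have "(\<integral>\<^sup>+i. ennreal (gibbs_weight t i) \<partial>count_space UNIV) = (\<Sum>i<n. ennreal (gibbs_weight t i))"
    by (rule nn_integral_count_space') (auto simp: gibbs_weight_def split: if_splits)
  then show "(\<integral>\<^sup>+i. ennreal (gibbs_weight t i) \<partial>count_space UNIV) = 1"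
    using sum_gibbs_weight gibbs_weight_nonneg by simp
qed (rule gibbs_weight_nonneg)

lemma set_gibbs_pmf: "set_pmf (gibbs_pmf t) \<subseteq> {..<n}"
  by (auto simp: set_pmf_eq pmf_gibbs_pmf gibbs_weight_def)

text \<open>This is the derivative of \<open>pressure\<close>, written as the mean of
  \<open>log_slope\<close> under the weights \<open>gibbs_weight t\<close>.\<close>

definition mean_log_slope :: "real \<Rightarrow> real" where
  "mean_log_slope t = (\<Sum>i<n. log_slope i * exp (t * log_slope i)) / partition_sum t"

lemma expectation_log_slope:
  "measure_pmf.expectation (gibbs_pmf t) log_slope = mean_log_slope t"
proof -
  have "measure_pmf.expectation (gibbs_pmf t) log_slope = (\<Sum>i<n. log_slope i * gibbs_weight t i)"
    using set_gibbs_pmf by (subst integral_measure_pmf_real[of "{..<n}"]) (auto simp: pmf_gibbs_pmf)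
  then show ?thesis
    unfolding mean_log_slope_def by (simp add: gibbs_weight_def sum_divide_distrib)
qed

lemma mean_log_slope_pos: "mean_log_slope t > 0"
  unfolding mean_log_slope_def using n_pos log_slope_pos partition_sum_pos
  by (intro divide_pos_pos sum_pos) auto

text \<open>The difference of the two sides is the entropy of \<open>gibbs_pmf t\<close>: it
  averages the numbers \<open>pressure t - t * log_slope i\<close>, each of which is minus the
  logarithm of a weight at most 1.\<close>

lemma entropy_nonneg: "t * mean_log_slope t \<le> pressure t"
proof -
  have le: "t * log_slope i \<le> pressure t" if "i < n" for i
  proof -
    have "exp (t * log_slope i) \<le> partition_sum t"
      unfolding partition_sum_def using that by (intro member_le_sum) auto
    then show ?thesis
      unfolding pressure_def using partition_sum_pos[of t] by (simp add: ln_ge_iff)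
  qed
  have "t * mean_log_slope t = (\<Sum>i<n. (t * log_slope i) * gibbs_weight t i)"
    unfolding mean_log_slope_def gibbs_weight_def by (simp add: sum_divide_distrib sum_distrib_left mult_ac)
  also have "\<dots> \<le> (\<Sum>i<n. pressure t * gibbs_weight t i)"
    using le gibbs_weight_nonneg by (intro sum_mono mult_right_mono) auto
  also have "\<dots> = pressure t" by (simp add: sum_gibbs_weight flip: sum_distrib_left)
  finally show ?thesis .
qed

abbreviation gibbs_measure :: "real \<Rightarrow> (nat \<Rightarrow> nat) measure" where
  "gibbs_measure t \<equiv> PiM (UNIV :: nat set) (\<lambda>_. measure_pmf (gibbs_pmf t))"

lemma AE_gibbs_measure_itinerary: "AE w in gibbs_measure t. \<forall>k. w k < n"
proof -
  interpret product_prob_space "\<lambda>_. measure_pmf (gibbs_pmf t)" "UNIV :: nat set" by unfold_locales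
  have "AE w in gibbs_measure t. w k < n" for k
    by (rule AE_component) (use set_gibbs_pmf in \<open>auto simp: AE_measure_pmf_iff\<close>)
  then show ?thesis by (simp add: AE_all_countable)
qed

lemma AE_gibbs_measure_lyapunov:
  "AE w in gibbs_measure t. (\<lambda>m. log_slope_sum w m / real m) \<longlonglongrightarrow> mean_log_slope t"
proof -
  have "\<bar>log_slope i\<bar> \<le> Max ((\<lambda>i. \<bar>log_slope i\<bar>) ` {..<n})" if "i \<in> set_pmf (gibbs_pmf t)" for i
    using set_gibbs_pmf that by (intro Max_ge) auto
  from strong_law_PiM_bounded[where P = "gibbs_pmf t" and f = log_slope, OF this] show ?thesis
    unfolding log_slope_sum_def expectation_log_slope .
qed

definition word_cylinder :: "nat \<Rightarrow> (nat \<Rightarrow> nat) \<Rightarrow> (nat \<Rightarrow> nat) set" where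
  "word_cylinder m u = {w. \<forall>k<m. w k = u k}"

lemma word_cylinder_gibbs_measure:
  assumes "\<And>k. k < m \<Longrightarrow> u k < n"
  shows "word_cylinder m u \<in> sets (gibbs_measure t)"
    and "emeasure (gibbs_measure t) (word_cylinder m u) =
      ennreal (exp (t * log_slope_sum u m - real m * pressure t))"
proof -
  interpret product_prob_space "\<lambda>_. measure_pmf (gibbs_pmf t)" "UNIV :: nat set" by unfold_locales
  have eq: "word_cylinder m u = {w \<in> space (gibbs_measure t). \<forall>k\<in>{..<m}. w k \<in> {u k}}"
    by (auto simp: word_cylinder_def space_PiM)
  show "word_cylinder m u \<in> sets (gibbs_measure t)"
    unfolding eq by (intro sets.sets_Collect_finite_All sets_Collect_single') auto
  have "emeasure (gibbs_measure t) (word_cylinder m u) =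
      (\<Prod>k<m. emeasure (measure_pmf (gibbs_pmf t)) {u k})"
    unfolding eq by (rule emeasure_PiM_Collect) auto
  also have "\<dots> = (\<Prod>k<m. ennreal (exp (t * log_slope (u k)) / partition_sum t))"
    using assms by (intro prod.cong) (auto simp: emeasure_pmf_single pmf_gibbs_pmf gibbs_weight_def)
  also have "\<dots> = ennreal (\<Prod>k<m. exp (t * log_slope (u k)) / partition_sum t)"
    using partition_sum_pos[of t] by (intro prod_ennreal) auto
  also have "(\<Prod>k<m. exp (t * log_slope (u k)) / partition_sum t) =
      exp (t * log_slope_sum u m) / partition_sum t ^ m"
    by (simp add: prod_dividef log_slope_sum_def sum_distrib_left exp_sum)
  also have "partition_sum t ^ m = exp (real m * pressure t)"
    unfolding pressure_def using partition_sum_pos[of t] by (simp add: exp_of_nat_mult)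
  finally show "emeasure (gibbs_measure t) (word_cylinder m u) =
      ennreal (exp (t * log_slope_sum u m - real m * pressure t))"
    by (simp add: exp_diff)
qed

text \<open>The mass distribution estimate: at the level where the shortest admissible cylinders have length
  about \<open>r\<close>, a set of diameter \<open>r\<close> meets at most four of them.\<close>

lemma gibbs_measure_small_set:
  assumes s: "s \<ge> 0" and \<kappa>: "\<kappa> > 0" "\<alpha> + \<epsilon> = \<kappa>" "\<epsilon> \<ge> 0"
    and dim: "s * \<kappa> \<le> pressure t - t * \<alpha> - \<bar>t\<bar> * \<epsilon>"
    and r: "0 < r" "r \<le> exp (- \<kappa> * real N)"
    and U: "bounded U" "diameter U \<le> r"
  obtains B where "B \<in> sets (gibbs_measure t)"
    "emeasure (gibbs_measure t) B \<le> ennreal (4 * exp (s * \<kappa>) * r powr s)"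
    "\<And>w x. (\<forall>k. w k < n) \<Longrightarrow> (\<forall>m\<ge>N. \<bar>log_slope_sum w m - real m * \<alpha>\<bar> \<le> real m * \<epsilon>) \<Longrightarrow>
      (\<forall>m. biter w m x \<in> {0..1}) \<Longrightarrow> x \<in> U \<Longrightarrow> w \<in> B"
proof -
  \<comment> \<open>This is the largest m with exp(-\<kappa> m) at least r. Admissible cylinders of
    level m have length at least r, while exp(-\<kappa> m) exceeds r by a factor of at most exp
    \<kappa>; hence the factor \<open>exp (s * \<kappa>)\<close> in the bound.\<close>
  define m where "m = nat \<lfloor>- ln r / \<kappa>\<rfloor>"
  have "ln r \<le> ln (exp (- \<kappa> * real N))" using r by (subst ln_le_cancel_iff) auto
  then have lnr: "ln r \<le> - \<kappa> * real N" by simp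
  then have N_le: "real N \<le> - ln r / \<kappa>" using \<kappa>(1) by (simp add: field_simps)
  then have "0 \<le> - ln r / \<kappa>" by (rule order_trans[rotated]) simp
  then have m: "real m \<le> - ln r / \<kappa>" "- ln r / \<kappa> < real m + 1"
    unfolding m_def by linarith+
  have "N \<le> m" using N_le m(2) by linarith
  have r_le: "r \<le> exp (- \<kappa> * real m)"
  proof -
    have "ln r \<le> - \<kappa> * real m" using m(1) \<kappa>(1) by (simp add: field_simps)
    then have "exp (ln r) \<le> exp (- \<kappa> * real m)" by (simp only: exp_le_cancel_iff)
    then show ?thesis using r(1) by simp
  qed
  have r_ge: "- \<kappa> * real m \<le> \<kappa> + ln r"
    using m(2) \<kappa>(1) by (simp add: field_simps)
  define W where "W = {u \<in> PiE {..<m} (\<lambda>_. {..<n}).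
    \<bar>log_slope_sum u m - real m * \<alpha>\<bar> \<le> real m * \<epsilon> \<and> cylinder u m \<inter> U \<noteq> {}}"
  define B where "B = (\<Union>u\<in>W. word_cylinder m u)"
  have "finite (PiE {..<m} (\<lambda>_. {..<n}))" by (intro finite_PiE) auto
  then have finW: "finite W" by (simp add: W_def)
  have un: "u k < n" if "u \<in> W" "k < m" for u k using that unfolding W_def by blast
  have card: "card W \<le> 4"
  proof (rule card_cylinders_meeting_le[OF _ r(1) _ _ U])
    fix u assume "u \<in> W"
    then have "\<bar>log_slope_sum u m - real m * \<alpha>\<bar> \<le> real m * \<epsilon>" by (simp add: W_def)
    then have "log_slope_sum u m \<le> \<kappa> * real m" unfolding \<kappa>(2)[symmetric] by (simp add: algebra_simps abs_le_iff)
    then have "exp (- \<kappa> * real m) \<le> exp (- log_slope_sum u m)" by simp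
    with r_le show "r \<le> exp (- log_slope_sum u m)" by (rule order_trans)
  qed (auto simp: W_def)
  have weight: "emeasure (gibbs_measure t) (word_cylinder m u) \<le> ennreal (exp (s * \<kappa>) * r powr s)"
    if u: "u \<in> W" for u
  proof -
    have "t * log_slope_sum u m - t * (real m * \<alpha>) \<le> \<bar>t * (log_slope_sum u m - real m * \<alpha>)\<bar>"
      by (simp add: right_diff_distrib)
    also have "\<dots> \<le> \<bar>t\<bar> * (real m * \<epsilon>)"
      using u unfolding abs_mult W_def by (intro mult_left_mono) auto
    finally have "t * log_slope_sum u m - real m * pressure t
        \<le> - (real m * (pressure t - t * \<alpha> - \<bar>t\<bar> * \<epsilon>))"
      by (simp add: algebra_simps)
    \<comment> \<open>Here the dimension hypothesis turns the Gibbs weight of an admissible word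
      into the s-th power of its minimal cylinder length.\<close>
    also have "\<dots> \<le> - (real m * (s * \<kappa>))"
      using dim by (simp add: mult_left_mono)
    also have "\<dots> = s * (- \<kappa> * real m)" by simp
    also have "\<dots> \<le> s * (\<kappa> + ln r)" using r_ge s by (rule mult_left_mono)
    finally have "exp (t * log_slope_sum u m - real m * pressure t) \<le> exp (s * \<kappa>) * r powr s"
      using r(1) by (simp add: powr_def distrib_left flip: exp_add)
    then show ?thesis
      using word_cylinder_gibbs_measure(2)[where u = u and m = m, OF un[OF u]] by (simp add: ennreal_leI)
  qed
  show ?thesis
  proof (rule that[of B])
    show "B \<in> sets (gibbs_measure t)"
      unfolding B_def using finW word_cylinder_gibbs_measure(1)[where m = m, OF un] by (intro sets.finite_UN) auto
    have "emeasure (gibbs_measure t) B \<le> (\<Sum>u\<in>W. emeasure (gibbs_measure t) (word_cylinder m u))"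
      unfolding B_def using finW word_cylinder_gibbs_measure(1)[where m = m, OF un]
      by (intro emeasure_subadditive_finite) auto
    also have "\<dots> \<le> (\<Sum>u\<in>W. ennreal (exp (s * \<kappa>) * r powr s))"
      using weight by (rule sum_mono)
    also have "\<dots> = ennreal (real (card W) * (exp (s * \<kappa>) * r powr s))"
      by (simp add: ennreal_mult ennreal_of_nat_eq_real_of_nat)
    also have "\<dots> \<le> ennreal (4 * (exp (s * \<kappa>) * r powr s))"
      using card by (intro ennreal_leI mult_right_mono) auto
    finally show "emeasure (gibbs_measure t) B \<le> ennreal (4 * exp (s * \<kappa>) * r powr s)"
      by (simp only: mult.assoc)
  next
    fix w x assume w: "\<forall>k. w k < n" "\<forall>m. biter w m x \<in> {0..1}" "x \<in> U"
      "\<forall>m\<ge>N. \<bar>log_slope_sum w m - real m * \<alpha>\<bar> \<le> real m * \<epsilon>"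
    have eq: "log_slope_sum (restrict w {..<m}) m = log_slope_sum w m"
        "cylinder (restrict w {..<m}) m = cylinder w m"
      by (rule log_slope_sum_cong cylinder_cong; simp)+
    have "x \<in> cylinder w m" using w(2) by (simp add: cylinder_def)
    then have "restrict w {..<m} \<in> W"
      unfolding W_def using w \<open>N \<le> m\<close> by (auto simp: eq)
    then show "w \<in> B" unfolding B_def by (rule UN_I) (simp add: word_cylinder_def)
  qed
qed

text \<open>A cover of the level set of cost e yields measurable sets of itineraries of total Gibbs
  measure at most a constant times e. They contain all itineraries whose deviations are controlled
  from N on, so these form a null set; yet almost every itinerary is of this kind for some N.
  Arguing on itineraries with measurable supersets sidesteps the measurability of the coding and of
  \<open>G N\<close>.\<close>

lemma coded_level_set_not_null:
  assumes s: "s > 0" and less: "(s + t) * mean_log_slope t < pressure t"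
  shows "hausdorff_measure s (coded_level_set (mean_log_slope t)) \<noteq> 0"
proof
  assume null: "hausdorff_measure s (coded_level_set (mean_log_slope t)) = 0"
  interpret product_prob_space "\<lambda>_. measure_pmf (gibbs_pmf t)" "UNIV :: nat set" by unfold_locales
  define \<alpha> where "\<alpha> = mean_log_slope t"
  \<comment> \<open>The value solves (s + |t|) \<epsilon> = P - (s + t) \<alpha>, so the dimension
    hypothesis of the small-set estimate holds with equality.\<close>
  define \<epsilon> where "\<epsilon> = (pressure t - (s + t) * \<alpha>) / (s + \<bar>t\<bar>)"
  define \<kappa> where "\<kappa> = \<alpha> + \<epsilon>"
  have \<epsilon>: "\<epsilon> > 0" unfolding \<epsilon>_def using less s by (simp add: \<alpha>_def add_pos_nonneg)
  have \<kappa>: "\<kappa> > 0" using \<epsilon> mean_log_slope_pos[of t] by (simp add: \<kappa>_def \<alpha>_def)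
  have "(s + \<bar>t\<bar>) * \<epsilon> = pressure t - (s + t) * \<alpha>"
    unfolding \<epsilon>_def using s by simp
  then have dim: "s * \<kappa> \<le> pressure t - t * \<alpha> - \<bar>t\<bar> * \<epsilon>"
    by (simp add: \<kappa>_def algebra_simps)
  define K where "K = 4 * exp (s * \<kappa>)"
  have K: "K > 0" by (simp add: K_def)
  define G where "G N = {w. (\<forall>k. w k < n) \<and> (\<lambda>m. log_slope_sum w m / real m) \<longlonglongrightarrow> \<alpha> \<and>
    (\<forall>m\<ge>N. \<bar>log_slope_sum w m - real m * \<alpha>\<bar> \<le> real m * \<epsilon>)}" for N
  have G_small: "\<exists>B \<in> sets (gibbs_measure t). G N \<subseteq> B \<and> emeasure (gibbs_measure t) B \<le> ennreal (K * (2 * e))"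
    if "e > 0" for N e
  proof -
    define r0 where "r0 = exp (- \<kappa> * real N)"
    have r0: "r0 > 0" by (simp add: r0_def)
    obtain U where U: "coded_level_set \<alpha> \<subseteq> (\<Union>k. U k)"
        "\<And>k::nat. bounded (U k) \<and> diameter (U k) \<le> r0" "(\<Sum>k. diam_pow s (U k)) < ennreal e"
      using null[folded \<alpha>_def, unfolded hausdorff_measure_eq_0_iff] r0 \<open>e > 0\<close> by meson
    define \<eta> where "\<eta> k = e * (1/2) ^ Suc k" for k :: nat
    have \<eta>: "\<eta> k > 0" for k using \<open>e > 0\<close> by (simp add: \<eta>_def)
    \<comment> \<open>The estimate needs a positive radius, while a cover set may have diameter 0
      and cost nothing. Such a set gets a radius whose s-th power is at most
      \<open>\<eta> k\<close>; these extra costs sum to at most e, hence the bound 2 e.\<close>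
    define r where "r k = (if diameter (U k) = 0 then min r0 (\<eta> k powr (1/s)) else diameter (U k))" for k
    have r: "0 < r k" "r k \<le> r0" "diameter (U k) \<le> r k" for k
      using U(2)[of k] r0 \<eta>[of k] diameter_ge_0[of "U k"] by (auto simp: r_def)
    have r_pow: "ennreal (r k powr s) \<le> diam_pow s (U k) + ennreal (\<eta> k)" for k
    proof (cases "diameter (U k) = 0")
      case True
      have "r k powr s \<le> (\<eta> k powr (1/s)) powr s"
        using r(1)[of k] s True by (intro powr_mono2) (auto simp: r_def)
      also have "\<dots> = \<eta> k" using s \<eta>[of k] by (simp add: powr_powr)
      finally show ?thesis by (simp add: ennreal_leI add_increasing)
    next
      case False
      then have "U k \<noteq> {}" by auto
      with False show ?thesis using s by (simp add: r_def diam_pow_def)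
    qed
    have "\<exists>B. B \<in> sets (gibbs_measure t) \<and>
        emeasure (gibbs_measure t) B \<le> ennreal (4 * exp (s * \<kappa>) * r k powr s) \<and>
        (\<forall>w x. (\<forall>k. w k < n) \<longrightarrow> (\<forall>m\<ge>N. \<bar>log_slope_sum w m - real m * \<alpha>\<bar> \<le> real m * \<epsilon>) \<longrightarrow>
          (\<forall>m. biter w m x \<in> {0..1}) \<longrightarrow> x \<in> U k \<longrightarrow> w \<in> B)" for k
      by (rule gibbs_measure_small_set[OF less_imp_le[OF s] \<kappa> \<kappa>_def[symmetric] less_imp_le[OF \<epsilon>] dim r(1)
            r(2)[unfolded r0_def] conjunct1[OF U(2)] r(3)]) blast
    then obtain B where B: "\<And>k. B k \<in> sets (gibbs_measure t)"
        "\<And>k. emeasure (gibbs_measure t) (B k) \<le> ennreal (K * r k powr s)"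
        "\<And>k w x. (\<forall>k. w k < n) \<Longrightarrow> (\<forall>m\<ge>N. \<bar>log_slope_sum w m - real m * \<alpha>\<bar> \<le> real m * \<epsilon>) \<Longrightarrow>
          (\<forall>m. biter w m x \<in> {0..1}) \<Longrightarrow> x \<in> U k \<Longrightarrow> w \<in> B k"
      unfolding K_def by metis
    have "G N \<subseteq> (\<Union>k. B k)"
    proof
      fix w assume "w \<in> G N"
      then have w: "\<forall>k. w k < n" "(\<lambda>m. log_slope_sum w m / real m) \<longlonglongrightarrow> \<alpha>"
          "\<forall>m\<ge>N. \<bar>log_slope_sum w m - real m * \<alpha>\<bar> \<le> real m * \<epsilon>"
        unfolding G_def by auto
      obtain x where x: "\<And>m. biter w m x \<in> {0..1}"
        using exists_point_with_itinerary[of w] w(1) by blast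
      then have "x \<in> coded_level_set \<alpha>" using w unfolding coded_level_set_def by blast
      then obtain k where "x \<in> U k" using U(1) by blast
      then have "w \<in> B k" using B(3) w x by blast
      then show "w \<in> (\<Union>k. B k)" by blast
    qed
    moreover have "emeasure (gibbs_measure t) (\<Union>k. B k) \<le> ennreal (K * (2 * e))"
    proof -
      have "emeasure (gibbs_measure t) (\<Union>k. B k) \<le> (\<Sum>k. emeasure (gibbs_measure t) (B k))"
        using B(1) by (intro emeasure_subadditive_countably) auto
      also have "\<dots> \<le> (\<Sum>k. ennreal K * (diam_pow s (U k) + ennreal (\<eta> k)))"
      proof (rule suminf_le)
        fix k
        have "emeasure (gibbs_measure t) (B k) \<le> ennreal K * ennreal (r k powr s)"
          using B(2)[of k] K by (simp add: ennreal_mult)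
        also have "\<dots> \<le> ennreal K * (diam_pow s (U k) + ennreal (\<eta> k))"
          using r_pow by (rule mult_left_mono) simp
        finally show "emeasure (gibbs_measure t) (B k) \<le> ennreal K * (diam_pow s (U k) + ennreal (\<eta> k))" .
      qed auto
      also have "\<dots> = ennreal K * ((\<Sum>k. diam_pow s (U k)) + (\<Sum>k. ennreal (\<eta> k)))"
        by (simp add: suminf_add[symmetric])
      also have "(\<Sum>k. ennreal (\<eta> k)) = ennreal e"
      proof (rule suminf_ennreal_eq)
        show "\<eta> sums e" using sums_mult[OF power_half_series, of e] by (simp add: \<eta>_def[abs_def])
      qed (use \<eta> in \<open>auto intro: less_imp_le\<close>)
      also have "ennreal K * ((\<Sum>k. diam_pow s (U k)) + ennreal e) \<le> ennreal K * (ennreal e + ennreal e)"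
        using U(3) by (intro mult_left_mono add_right_mono) auto
      also have "\<dots> = ennreal (K * (2 * e))"
        using K \<open>e > 0\<close> by (simp add: ennreal_mult flip: ennreal_plus)
      finally show ?thesis .
    qed
    ultimately show ?thesis using B(1) by (intro bexI[of _ "\<Union>k. B k"]) auto
  qed
  have "AE w in gibbs_measure t. w \<notin> G N" for N
  proof -
    \<comment> \<open>The cost 1 / (2 K (j+1)) is chosen so that the resulting bound on the measure
      is 1 / (j+1).\<close>
    have "\<forall>j::nat. \<exists>B \<in> sets (gibbs_measure t). G N \<subseteq> B \<and>
        emeasure (gibbs_measure t) B \<le> ennreal (K * (2 * (1 / (2 * K * real (Suc j)))))"
      using K by (intro allI G_small) simp
    then obtain B where B: "\<And>j. B j \<in> sets (gibbs_measure t)" "\<And>j. G N \<subseteq> B j"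
        "\<And>j. emeasure (gibbs_measure t) (B j) \<le> ennreal (K * (2 * (1 / (2 * K * real (Suc j)))))"
      by metis
    have "emeasure (gibbs_measure t) (\<Inter>j. B j) \<le> 0"
    proof (rule ennreal_le_epsilon)
      fix e :: real assume "e > 0"
      then obtain j where j: "1 / real (Suc j) < e" using nat_approx_posE by blast
      have "emeasure (gibbs_measure t) (\<Inter>j. B j) \<le> emeasure (gibbs_measure t) (B j)"
        by (rule emeasure_mono) (use B(1) in auto)
      also have "\<dots> \<le> ennreal (1 / real (Suc j))"
        using B(3)[of j] K by simp
      also have "\<dots> \<le> ennreal e" using j by (intro ennreal_leI) simp
      finally show "emeasure (gibbs_measure t) (\<Inter>j. B j) \<le> 0 + ennreal e" by simp
    qed
    then have "(\<Inter>j. B j) \<in> null_sets (gibbs_measure t)"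
      using B(1) by (intro null_setsI) auto
    then show ?thesis by (rule AE_not_in[THEN AE_mp]) (use B(2) in auto)
  qed
  then have "AE w in gibbs_measure t. \<forall>N. w \<notin> G N" by (simp add: AE_all_countable)
  with AE_gibbs_measure_itinerary[of t] AE_gibbs_measure_lyapunov[of t]
  have "AE w in gibbs_measure t. False"
  proof eventually_elim
    case (elim w)
    obtain N where N: "\<And>m. m \<ge> N \<Longrightarrow> \<bar>log_slope_sum w m / real m - \<alpha>\<bar> < \<epsilon>"
      using LIMSEQ_D[OF elim(2) \<epsilon>] by (auto simp: \<alpha>_def)
    have "\<bar>log_slope_sum w m - real m * \<alpha>\<bar> \<le> real m * \<epsilon>" if "m \<ge> N" for m
      using deviation_le[OF N[OF that]] .
    then have "w \<in> G N" using elim(1,2) by (simp add: G_def \<alpha>_def)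
    then show False using elim(3) by blast
  qed
  then show False by simp
qed

end

context pl_map
begin

text \<open>The upper bound is available for every parameter; it is used at the t whose Gibbs
  measure has mean exactly the given exponent, where the lower bound matches it.\<close>

lemma hausdorff_dim_level_set:
  "hausdorff_dim (level_set (mean_log_slope t)) = ennreal (pressure t / mean_log_slope t - t)"
proof (rule hausdorff_dim_eqI)
  have pos: "mean_log_slope t > 0" by (rule mean_log_slope_pos)
  show nonneg: "0 \<le> pressure t / mean_log_slope t - t"
    using entropy_nonneg[of t] pos by (simp add: field_simps)
  show "hausdorff_measure s (level_set (mean_log_slope t)) = 0" if "pressure t / mean_log_slope t - t < s" for s
  proof -
    have "ln (partition_sum t) < (s + t) * mean_log_slope t"
      using that pos by (simp add: field_simps pressure_def)
    moreover have "s > 0" using that nonneg by linarith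
    ultimately show ?thesis using coded_level_set_null level_set_null_iff by blast
  qed
  show "hausdorff_measure s (level_set (mean_log_slope t)) \<noteq> 0"
    if "0 < s" "s < pressure t / mean_log_slope t - t" for s
  proof -
    have "(s + t) * mean_log_slope t < pressure t"
      using that pos by (simp add: field_simps)
    then show ?thesis using coded_level_set_not_null level_set_null_iff that(1) by blast
  qed
qed

lemma lyapunov_spectrum_eq:
  "lyapunov_spectrum (pl_domain n a b) T (mean_log_slope t) = pressure t / mean_log_slope t - t"
  unfolding lyapunov_spectrum_def hausdorff_dim_level_set
  using entropy_nonneg[of t] mean_log_slope_pos[of t] by (subst enn2real_ennreal) (auto simp: field_simps)

end

section \<open>Counting inflections\<close>

text \<open>The points of S are added in increasing order. The conjunct \<open>z < Max S\<close>
  makes the zero found between the old maximum and the new point different from all earlier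
  ones.\<close>

lemma rolle_finite_zeros:
  fixes g g' :: "real \<Rightarrow> real"
  assumes g: "\<And>x. (g has_real_derivative g' x) (at x)"
    and S: "finite S" "S \<noteq> {}" "\<And>x. x \<in> S \<Longrightarrow> g x = 0"
  shows "\<exists>Z. finite Z \<and> card S = Suc (card Z) \<and> (\<forall>z\<in>Z. g' z = 0 \<and> z < Max S)"
  using S
proof (induction S rule: finite_linorder_max_induct)
  case (insert b S)
  show ?case
  proof (cases "S = {}")
    case True
    then show ?thesis by (intro exI[of _ "{}"]) simp
  next
    case False
    then obtain Z where Z: "finite Z" "card S = Suc (card Z)" "\<forall>z\<in>Z. g' z = 0 \<and> z < Max S"
      using insert by auto
    have m: "Max S \<in> S" "Max S < b" using insert.hyps False by auto
    have "\<exists>z. Max S < z \<and> z < b \<and> DERIV g z :> 0"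
      using m insert.prems(2) g
      by (intro Rolle) (auto intro!: DERIV_isCont continuous_at_imp_continuous_on simp: real_differentiable_def)
    then obtain z where z: "Max S < z" "z < b" "g' z = 0" using g DERIV_unique by blast
    have "Max (insert b S) = b" using insert.hyps by (intro Max_eqI) (auto intro: less_imp_le)
    moreover have "z \<notin> Z" using Z(3) z(1) by force
    moreover have "b \<notin> S" using insert.hyps by blast
    ultimately show ?thesis
      using Z z m insert.hyps by (intro exI[of _ "insert z Z"]) auto
  qed
qed simp

text \<open>Finiteness is part of the claim, so Rolle is applied to a finite set of k + 2 zeros,
  which exists whether the zeros are infinite or merely too many.\<close>

lemma rolle_card_zeros:
  fixes g g' :: "real \<Rightarrow> real"
  assumes g: "\<And>x. (g has_real_derivative g' x) (at x)"
    and zeros: "finite {x. g' x = 0}" "card {x. g' x = 0} \<le> k"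
  shows "finite {x. g x = 0} \<and> card {x. g x = 0} \<le> Suc k"
proof (rule ccontr)
  assume "\<not> ?thesis"
  then obtain S where S: "finite S" "S \<subseteq> {x. g x = 0}" "card S = Suc (Suc k)"
    by (metis infinite_arbitrarily_large not_less_eq_eq obtain_subset_with_card_n)
  then have "S \<noteq> {}" by auto
  then obtain Z where Z: "finite Z" "card S = Suc (card Z)" "\<forall>z\<in>Z. g' z = 0 \<and> z < Max S"
    using rolle_finite_zeros[OF g S(1)] S(2) by blast
  then have "card Z \<le> card {x. g' x = 0}" using zeros(1) by (intro card_mono) auto
  with Z(2) S(3) zeros(2) show False by simp
qed

text \<open>A form of Descartes' rule of signs. Multiplying by \<open>exp (- c * t)\<close> and differentiating
  multiplies the coefficient of \<open>exp (e * t)\<close> by \<open>e - c\<close>; it annihilates the term with \<open>e = c\<close>, so that a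
  threshold may be placed on an exponent.\<close>

lemma exp_sum_card_zeros:
  fixes L :: "(real \<times> real) list"
  assumes "\<forall>(k, e) \<in> set L. 0 \<le> k * (\<Prod>c\<leftarrow>cs. e - c)" "\<exists>(k, e) \<in> set L. 0 < k * (\<Prod>c\<leftarrow>cs. e - c)"
  shows "finite {t. (\<Sum>(k, e)\<leftarrow>L. k * exp (e * t)) = 0} \<and>
    card {t. (\<Sum>(k, e)\<leftarrow>L. k * exp (e * t)) = 0} \<le> length cs"
  using assms
proof (induction cs arbitrary: L)
  case Nil
  have "(\<Sum>(k, e)\<leftarrow>L. k * exp (e * t)) > 0" for t
  proof -
    have nonneg: "(\<Sum>(k, e)\<leftarrow>L'. k * exp (e * t)) \<ge> 0" if "\<forall>(k, e) \<in> set L'. 0 \<le> k" for L'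
      using that by (intro sum_list_nonneg) auto
    obtain k e where "(k, e) \<in> set L" "0 < k" using Nil.prems(2) by auto
    then obtain L1 L2 where L: "L = L1 @ (k, e) # L2" by (meson split_list)
    have "0 \<le> (\<Sum>(k, e)\<leftarrow>L1. k * exp (e * t))" "0 \<le> (\<Sum>(k, e)\<leftarrow>L2. k * exp (e * t))"
      using Nil.prems(1) by (intro nonneg; auto simp: L)+
    then show ?thesis using \<open>0 < k\<close> by (simp add: L add_nonneg_pos add_pos_nonneg)
  qed
  then have "{t. (\<Sum>(k, e)\<leftarrow>L. k * exp (e * t)) = 0} = {}"
    by (metis (mono_tags, lifting) empty_Collect_eq less_irrefl)
  then show ?case by simp
next
  case (Cons c cs)
  define L' where "L' = map (\<lambda>(k, e). (k * (e - c), e)) L"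
  have IH: "finite {t. (\<Sum>(k, e)\<leftarrow>L'. k * exp (e * t)) = 0} \<and>
    card {t. (\<Sum>(k, e)\<leftarrow>L'. k * exp (e * t)) = 0} \<le> length cs"
    by (rule Cons.IH) (use Cons.prems in \<open>force simp: L'_def mult_ac\<close>)+
  define g where "g t = exp (- c * t) * (\<Sum>(k, e)\<leftarrow>L. k * exp (e * t))" for t
  define g' where "g' t = exp (- c * t) * (\<Sum>(k, e)\<leftarrow>L'. k * exp (e * t))" for t
  have "(g has_real_derivative g' t) (at t)" for t
  proof -
    have sum: "((\<lambda>t. \<Sum>(k, e)\<leftarrow>M. k * exp (e * t)) has_real_derivative (\<Sum>(k, e)\<leftarrow>M. k * e * exp (e * t))) (at t)"
      for M :: "(real \<times> real) list"
      by (induction M) (auto intro!: derivative_eq_intros)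
    have shift: "(\<Sum>(k, e)\<leftarrow>M. k * e * exp (e * t)) - c * (\<Sum>(k, e)\<leftarrow>M. k * exp (e * t)) =
        (\<Sum>(k, e)\<leftarrow>map (\<lambda>(k, e). (k * (e - c), e)) M. k * exp (e * t))" for M
      by (induction M) (auto simp: algebra_simps)
    have "((\<lambda>t. exp (- c * t)) has_real_derivative - c * exp (- c * t)) (at t)"
      by (auto intro!: derivative_eq_intros)
    from DERIV_mult[OF this sum[of L]] show ?thesis
      unfolding g_def[abs_def] g'_def L'_def shift[symmetric] by (simp add: algebra_simps)
  qed
  moreover have "{t. g' t = 0} = {t. (\<Sum>(k, e)\<leftarrow>L'. k * exp (e * t)) = 0}"
    by (simp add: g'_def)
  ultimately have "finite {t. g t = 0} \<and> card {t. g t = 0} \<le> Suc (length cs)"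
    using IH by (intro rolle_card_zeros) auto
  moreover have "{t. g t = 0} = {t. (\<Sum>(k, e)\<leftarrow>L. k * exp (e * t)) = 0}"
    by (simp add: g_def)
  ultimately show ?case by simp
qed

text \<open>Differentiating the parametrised identity gives L'(P1 t) P2 = - P P2 / P1^2, and
  cancelling P2 leaves L'(P1 t) = - P / P1^2 near t0. A second differentiation gives L'' P2 = (2 P
  P2 - P1^2) / P1^3.\<close>

lemma second_derivative_zero_legendre:
  fixes P P1 P2 L :: "real \<Rightarrow> real"
  assumes P: "\<And>t. (P has_real_derivative P1 t) (at t)"
    and P1: "\<And>t. (P1 has_real_derivative P2 t) (at t)"
    and pos: "\<And>t. P1 t > 0" "\<And>t. P2 t > 0"
    and L: "\<And>t. L (P1 t) = P t / P1 t - t"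
    and "has_second_derivative L 0 (P1 t0)"
  shows "P t0 - (P1 t0)\<^sup>2 / (2 * P2 t0) = 0"
proof -
  obtain f' where f': "\<forall>\<^sub>F y in nhds (P1 t0). (L has_real_derivative f' y) (at y)"
      "(f' has_real_derivative 0) (at (P1 t0))"
    using assms(6) unfolding has_second_derivative_def by blast
  have "(P1 \<longlongrightarrow> P1 t0) (nhds t0)"
    using DERIV_isCont[OF P1] by (simp add: isCont_def tendsto_nhds_iff)
  with f'(1) have "\<forall>\<^sub>F t in nhds t0. (L has_real_derivative f' (P1 t)) (at (P1 t))"
    by (rule eventually_compose_filterlim)
  then have eq: "\<forall>\<^sub>F t in nhds t0. f' (P1 t) = - P t / (P1 t)\<^sup>2"
  proof eventually_elim
    case (elim t)
    have "((\<lambda>t. L (P1 t)) has_real_derivative f' (P1 t) * P2 t) (at t)"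
      using DERIV_chain2[OF elim P1] .
    moreover have "((\<lambda>t. L (P1 t)) has_real_derivative - P t / (P1 t)\<^sup>2 * P2 t) (at t)"
      unfolding L using pos[of t]
      by (auto intro!: derivative_eq_intros P P1 simp: power2_eq_square field_simps)
    ultimately have "f' (P1 t) * P2 t = - P t / (P1 t)\<^sup>2 * P2 t" by (rule DERIV_unique)
    then show ?case using pos(2)[of t] by (simp only: mult_right_cancel[OF less_imp_neq[symmetric]])
  qed
  have "((\<lambda>t. f' (P1 t)) has_real_derivative 0 * P2 t0) (at t0)"
    by (rule DERIV_chain2[OF f'(2) P1])
  then have "((\<lambda>t. - P t / (P1 t)\<^sup>2) has_real_derivative 0) (at t0)"
    using DERIV_cong_ev[OF refl eq refl] by simp
  moreover have "((\<lambda>t. - P t / (P1 t)\<^sup>2) has_real_derivative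
      (2 * P t0 * P2 t0 - (P1 t0)\<^sup>2) / (P1 t0) ^ 3) (at t0)"
    using pos(1)[of t0]
    by (auto intro!: derivative_eq_intros P P1 simp: power2_eq_square power3_eq_cube field_simps)
  ultimately have "(2 * P t0 * P2 t0 - (P1 t0)\<^sup>2) / (P1 t0) ^ 3 = 0"
    by (rule DERIV_unique[symmetric])
  then show ?thesis using pos[of t0] by (simp add: field_simps)
qed

section \<open>Pressure of a sum of three exponentials and its derivatives\<close>

locale three_exponentials =
  fixes c1 c2 c3 y1 y2 y3 :: real
  assumes weights: "c1 > 0" "c2 > 0" "c3 > 0"
    and exponents: "0 < y1" "y1 < y2" "y2 < y3"
begin

text \<open>The k-th derivative of the partition sum, equally its unnormalised k-th moment.\<close>

definition moment :: "nat \<Rightarrow> real \<Rightarrow> real" where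
  "moment k t = c1 * y1 ^ k * exp (t * y1) + c2 * y2 ^ k * exp (t * y2) + c3 * y3 ^ k * exp (t * y3)"

lemma moment_pos: "moment k t > 0"
  unfolding moment_def using weights exponents by (intro add_pos_pos mult_pos_pos) auto

lemma DERIV_moment:
  "(moment k has_real_derivative moment (Suc k) t) (at t)"
  unfolding moment_def[abs_def] by (auto intro!: derivative_eq_intros simp: algebra_simps)

text \<open>The cumulant generating function and its first three derivatives: the mean, variance and
  third central moment of the exponents under the normalised weights.\<close>

definition "cgf t = ln (moment 0 t)"
definition "cgf1 t = moment 1 t / moment 0 t"
definition "cgf2 t = (moment 2 t * moment 0 t - (moment 1 t)\<^sup>2) / (moment 0 t)\<^sup>2"
definition "cgf3 t = (moment 3 t * (moment 0 t)\<^sup>2 - 3 * moment 0 t * moment 1 t * moment 2 t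
  + 2 * (moment 1 t) ^ 3) / (moment 0 t) ^ 3"

lemma DERIV_cgf: "(cgf has_real_derivative cgf1 t) (at t)"
  unfolding cgf_def[abs_def] cgf1_def using moment_pos[of 0 t]
  by (auto intro!: derivative_eq_intros DERIV_moment)

lemma DERIV_cgf1: "(cgf1 has_real_derivative cgf2 t) (at t)"
  unfolding cgf1_def[abs_def] cgf2_def using moment_pos[of 0 t]
  by (auto intro!: derivative_eq_intros DERIV_moment simp: power2_eq_square numeral_2_eq_2)

lemma DERIV_cgf2: "(cgf2 has_real_derivative cgf3 t) (at t)"
  unfolding cgf2_def[abs_def] cgf3_def using moment_pos[of 0 t]
  by (auto intro!: derivative_eq_intros DERIV_moment
      simp: field_simps power2_eq_square power3_eq_cube numeral_2_eq_2 numeral_3_eq_3)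

lemma cgf1_pos: "cgf1 t > 0"
  unfolding cgf1_def using moment_pos by simp

text \<open>The numerator of a variance is a sum over pairs of the squared differences of the
  exponents (Lagrange's identity), and the exponents are distinct.\<close>

lemma cgf2_pos: "cgf2 t > 0"
proof -
  define A B C where "A = c1 * exp (t * y1)" "B = c2 * exp (t * y2)" "C = c3 * exp (t * y3)"
  have ABC: "A > 0" "B > 0" "C > 0" using weights by (auto simp: A_B_C_def)
  have "moment 2 t * moment 0 t - (moment 1 t)\<^sup>2 =
      A * B * (y2 - y1)\<^sup>2 + A * C * (y3 - y1)\<^sup>2 + B * C * (y3 - y2)\<^sup>2"
    unfolding moment_def A_B_C_def by (simp add: power2_eq_square algebra_simps)
  also have "\<dots> > 0" using ABC exponents by (intro add_pos_pos mult_pos_pos) auto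
  finally show ?thesis unfolding cgf2_def using moment_pos[of 0 t] by simp
qed

lemma cgf3_card_zeros: "finite {t. cgf3 t = 0} \<and> card {t. cgf3 t = 0} \<le> 3"
proof -
  define a b where "a = y2 - y1" "b = y3 - y2"
  have ab: "a > 0" "b > 0" and y: "y2 = y1 + a" "y3 = y1 + a + b"
    using exponents by (auto simp: a_b_def)
  define N where "N t = moment 3 t * (moment 0 t)\<^sup>2 - 3 * moment 0 t * moment 1 t * moment 2 t
    + 2 * (moment 1 t) ^ 3" for t
  \<comment> \<open>These are the terms of -N; the sign is chosen so that the last one is positive.
    The coefficient of the mixed term is, up to this sign, c1 c2 c3 times the product of the numbers
    2 yi - yj - yk, so its sign is that of a - b.\<close>
  define L where "L =
   [(- (c1\<^sup>2 * c2 * a ^ 3), 3 * y1 + a), (- (c1\<^sup>2 * c3 * (a + b) ^ 3), 3 * y1 + (a + b)),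
    (c1 * c2\<^sup>2 * a ^ 3, 3 * y1 + 2 * a),
    (- (c1 * c2 * c3 * ((b - a) * (a + 2 * b) * (2 * a + b))), 3 * y1 + (2 * a + b)),
    (c1 * c3\<^sup>2 * (a + b) ^ 3, 3 * y1 + (2 * a + 2 * b)),
    (- (c2\<^sup>2 * c3 * b ^ 3), 3 * y1 + (3 * a + b)),
    (c2 * c3\<^sup>2 * b ^ 3, 3 * y1 + (3 * a + 2 * b))]"
  have N_eq: "(\<Sum>(k, e)\<leftarrow>L. k * exp (e * t)) = - N t" for t
  proof -
    define A B C where "A = exp (t * y1)" "B = exp (t * y2)" "C = exp (t * y3)"
    have e: "exp ((3 * y1 + a) * t) = A\<^sup>2 * B" "exp ((3 * y1 + (a + b)) * t) = A\<^sup>2 * C"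
      "exp ((3 * y1 + 2 * a) * t) = A * B\<^sup>2" "exp ((3 * y1 + (2 * a + b)) * t) = A * B * C"
      "exp ((3 * y1 + (2 * a + 2 * b)) * t) = A * C\<^sup>2" "exp ((3 * y1 + (3 * a + b)) * t) = B\<^sup>2 * C"
      "exp ((3 * y1 + (3 * a + 2 * b)) * t) = B * C\<^sup>2"
      unfolding A_B_C_def y power2_eq_square by (simp_all add: algebra_simps flip: exp_add)
    show ?thesis
      unfolding L_def N_def moment_def
      by (simp add: e flip: A_B_C_def) (simp add: y, algebra)
  qed
  have "finite {t. (\<Sum>(k, e)\<leftarrow>L. k * exp (e * t)) = 0} \<and>
    card {t. (\<Sum>(k, e)\<leftarrow>L. k * exp (e * t)) = 0} \<le> 3"
  proof (cases "a \<le> b")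
    case True
    \<comment> \<open>For a \<le> b the exponents, less 3 y1, are ordered a, 2a, a+b, 2a+b, 3a+b,
      2a+2b, 3a+2b, with signs - + - - - + + (the fourth may vanish). A threshold sits on the first
      exponent after each sign change; ties at a = b are harmless.\<close>
    define cs where "cs = [3 * y1 + 2 * a, 3 * y1 + (a + b), 3 * y1 + (2 * a + 2 * b)]"
    have vals: "map (\<lambda>(k, e). k * (\<Prod>c\<leftarrow>cs. e - c)) L =
      [c1\<^sup>2 * c2 * a ^ 3 * (a * b * (a + 2 * b)), 0, 0,
       c1 * c2 * c3 * ((b - a) * (a + 2 * b) * (2 * a + b) * (a * b * b)), 0,
       c2\<^sup>2 * c3 * b ^ 3 * ((a + b) * (2 * a) * (b - a)),
       c2 * c3\<^sup>2 * b ^ 3 * ((a + 2 * b) * (2 * a + b) * a)]"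
      unfolding L_def cs_def by (simp add: algebra_simps power2_eq_square power3_eq_cube)
    have "\<forall>v \<in> set (map (\<lambda>(k, e). k * (\<Prod>c\<leftarrow>cs. e - c)) L). 0 \<le> v"
      unfolding vals using ab weights True by simp
    moreover have "0 < c1\<^sup>2 * c2 * a ^ 3 * (a * b * (a + 2 * b))"
      using ab weights by simp
    then have "\<exists>v \<in> set (map (\<lambda>(k, e). k * (\<Prod>c\<leftarrow>cs. e - c)) L). 0 < v"
      unfolding vals by (intro bexI) auto
    ultimately show ?thesis
      using exp_sum_card_zeros[of L cs] by (auto simp: case_prod_beta cs_def)
  next
    case False
    \<comment> \<open>For a > b the order becomes a, a+b, 2a, 2a+b, 2a+2b, 3a+b, 3a+2b, with signs -
      - + + + - +. Each threshold sits on an exponent next to a sign change, and every remaining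
      term becomes positive.\<close>
    define cs where "cs = [3 * y1 + (a + b), 3 * y1 + (2 * a + 2 * b), 3 * y1 + (3 * a + b)]"
    have vals: "map (\<lambda>(k, e). k * (\<Prod>c\<leftarrow>cs. e - c)) L =
      [c1\<^sup>2 * c2 * a ^ 3 * (b * (a + 2 * b) * (2 * a + b)), 0,
       c1 * c2\<^sup>2 * a ^ 3 * ((a - b) * (2 * b) * (a + b)),
       c1 * c2 * c3 * ((a - b) * (a + 2 * b) * (2 * a + b) * (a * b * a)), 0, 0,
       c2 * c3\<^sup>2 * b ^ 3 * ((2 * a + b) * a * b)]"
      unfolding L_def cs_def by (simp add: algebra_simps power2_eq_square power3_eq_cube)
    have "\<forall>v \<in> set (map (\<lambda>(k, e). k * (\<Prod>c\<leftarrow>cs. e - c)) L). 0 \<le> v"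
      unfolding vals using ab weights False by simp
    moreover have "0 < c1\<^sup>2 * c2 * a ^ 3 * (b * (a + 2 * b) * (2 * a + b))"
      using ab weights by simp
    then have "\<exists>v \<in> set (map (\<lambda>(k, e). k * (\<Prod>c\<leftarrow>cs. e - c)) L). 0 < v"
      unfolding vals by (intro bexI) auto
    ultimately show ?thesis
      using exp_sum_card_zeros[of L cs] by (auto simp: case_prod_beta cs_def)
  qed
  moreover have "{t. cgf3 t = 0} = {t. (\<Sum>(k, e)\<leftarrow>L. k * exp (e * t)) = 0}"
    unfolding N_eq cgf3_def N_def[symmetric] using moment_pos[of 0] by (auto simp: less_imp_neq[symmetric])
  ultimately show ?thesis by simp
qed

lemma inflection_function_card_zeros:
  "finite {t. cgf t - (cgf1 t)\<^sup>2 / (2 * cgf2 t) = 0} \<and>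
    card {t. cgf t - (cgf1 t)\<^sup>2 / (2 * cgf2 t) = 0} \<le> 4"
proof -
  define h where "h t = cgf t - (cgf1 t)\<^sup>2 / (2 * cgf2 t)" for t
  define h' where "h' t = (cgf1 t)\<^sup>2 * cgf3 t / (2 * (cgf2 t)\<^sup>2)" for t
  have "(h has_real_derivative h' t) (at t)" for t
    unfolding h_def[abs_def] h'_def using cgf2_pos[of t]
    by (auto intro!: derivative_eq_intros DERIV_cgf DERIV_cgf1 DERIV_cgf2
        simp: power2_eq_square field_simps)
  moreover have "{t. h' t = 0} = {t. cgf3 t = 0}"
    using cgf1_pos cgf2_pos by (auto simp: h'_def less_imp_neq[symmetric])
  ultimately have "finite {t. h t = 0} \<and> card {t. h t = 0} \<le> Suc 3"
    using cgf3_card_zeros by (intro rolle_card_zeros) auto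
  then show ?thesis by (simp add: h_def)
qed

text \<open>D has the sign of \<open>cgf1 t - \<alpha>\<close>. Factoring out the dominant
  exponential, that of y3 at plus infinity and that of y1 at minus infinity, leaves the signs of y3
  - \<alpha> and y1 - \<alpha>; a zero in between follows by continuity.\<close>

lemma cgf1_surj:
  assumes "y1 < \<alpha>" "\<alpha> < y3"
  obtains t where "cgf1 t = \<alpha>"
proof -
  define D where "D t = moment 1 t - \<alpha> * moment 0 t" for t
  have D: "D t = c1 * (y1 - \<alpha>) * exp (t * y1) + c2 * (y2 - \<alpha>) * exp (t * y2) + c3 * (y3 - \<alpha>) * exp (t * y3)" for t
    by (simp add: D_def moment_def algebra_simps)
  have shift: "exp (t * x) = exp (t * (x - z)) * exp (t * z)" for t x z :: real
    by (simp add: algebra_simps flip: exp_add)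
  have lim: "((\<lambda>t. exp (t * c)) \<longlongrightarrow> 0) at_top" if "c < 0" for c :: real
  proof -
    have "filterlim (\<lambda>t. c * t) at_bot at_top"
      by (rule filterlim_tendsto_neg_mult_at_bot[OF tendsto_const that filterlim_ident])
    from filterlim_compose[OF exp_at_bot this] show ?thesis by (simp add: mult.commute)
  qed
  have lim': "((\<lambda>t. exp (t * c)) \<longlongrightarrow> 0) at_bot" if "c > 0" for c :: real
    unfolding at_bot_mirror filterlim_filtermap using lim[of "-c"] that by simp
  have "((\<lambda>t. c1 * (y1 - \<alpha>) * exp (t * (y1 - y3)) + c2 * (y2 - \<alpha>) * exp (t * (y2 - y3)) + c3 * (y3 - \<alpha>))
      \<longlongrightarrow> c1 * (y1 - \<alpha>) * 0 + c2 * (y2 - \<alpha>) * 0 + c3 * (y3 - \<alpha>)) at_top"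
    using exponents by (intro tendsto_intros lim) auto
  moreover have "c3 * (y3 - \<alpha>) > 0" using assms weights by simp
  ultimately have "\<forall>\<^sub>F t in at_top. 0 < c1 * (y1 - \<alpha>) * exp (t * (y1 - y3)) + c2 * (y2 - \<alpha>) * exp (t * (y2 - y3)) + c3 * (y3 - \<alpha>)"
    by (intro order_tendstoD) auto
  then have "\<forall>\<^sub>F t in at_top. 0 \<le> t \<and> 0 < D t"
    using eventually_ge_at_top[of 0]
  proof eventually_elim
    case (elim t)
    have "D t = (c1 * (y1 - \<alpha>) * exp (t * (y1 - y3)) + c2 * (y2 - \<alpha>) * exp (t * (y2 - y3)) + c3 * (y3 - \<alpha>)) * exp (t * y3)"
      unfolding D by (simp add: distrib_right shift[of t y1 y3] shift[of t y2 y3])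
    then show ?case using elim by simp
  qed
  then obtain r where r: "0 \<le> r" "0 < D r" using eventually_happens trivial_limit_at_top_linorder by blast
  have "((\<lambda>t. c1 * (y1 - \<alpha>) + c2 * (y2 - \<alpha>) * exp (t * (y2 - y1)) + c3 * (y3 - \<alpha>) * exp (t * (y3 - y1)))
      \<longlongrightarrow> c1 * (y1 - \<alpha>) + c2 * (y2 - \<alpha>) * 0 + c3 * (y3 - \<alpha>) * 0) at_bot"
    using exponents by (intro tendsto_intros lim') auto
  moreover have "c1 * (y1 - \<alpha>) < 0" using assms weights by (simp add: mult_pos_neg)
  ultimately have "\<forall>\<^sub>F t in at_bot. c1 * (y1 - \<alpha>) + c2 * (y2 - \<alpha>) * exp (t * (y2 - y1)) + c3 * (y3 - \<alpha>) * exp (t * (y3 - y1)) < 0"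
    by (intro order_tendstoD) auto
  then have "\<forall>\<^sub>F t in at_bot. t \<le> 0 \<and> D t < 0"
    using eventually_le_at_bot[of 0]
  proof eventually_elim
    case (elim t)
    have "D t = (c1 * (y1 - \<alpha>) + c2 * (y2 - \<alpha>) * exp (t * (y2 - y1)) + c3 * (y3 - \<alpha>) * exp (t * (y3 - y1))) * exp (t * y1)"
      unfolding D by (simp add: distrib_right shift[of t y2 y1] shift[of t y3 y1])
    then show ?case using elim by (simp add: mult_neg_pos)
  qed
  then obtain l where l: "l \<le> 0" "D l < 0" using eventually_happens trivial_limit_at_bot_linorder by blast
  have "continuous_on {l..r} D"
    unfolding D by (intro continuous_intros)
  then obtain t where "D t = 0" using IVT'[of D l 0 r] l r by auto
  then have "cgf1 t = \<alpha>" unfolding D_def cgf1_def using moment_pos[of 0 t] by (simp add: field_simps)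
  then show ?thesis by (rule that)
qed

lemma card_legendre_inflections:
  assumes L: "\<And>t. L (cgf1 t) = cgf t / cgf1 t - t"
  shows "finite {\<alpha>. y1 < \<alpha> \<and> \<alpha> < y3 \<and> has_second_derivative L 0 \<alpha>} \<and>
    card {\<alpha>. y1 < \<alpha> \<and> \<alpha> < y3 \<and> has_second_derivative L 0 \<alpha>} \<le> 4"
proof -
  define Z where "Z = {t. cgf t - (cgf1 t)\<^sup>2 / (2 * cgf2 t) = 0}"
  have Z: "finite Z" "card Z \<le> 4" using inflection_function_card_zeros by (auto simp: Z_def)
  have "{\<alpha>. y1 < \<alpha> \<and> \<alpha> < y3 \<and> has_second_derivative L 0 \<alpha>} \<subseteq> cgf1 ` Z" (is "?I \<subseteq> _")
  proof
    fix \<alpha> assume \<alpha>: "\<alpha> \<in> ?I"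
    then obtain t where t: "cgf1 t = \<alpha>" using cgf1_surj by blast
    then have "t \<in> Z"
      unfolding Z_def using second_derivative_zero_legendre[OF DERIV_cgf DERIV_cgf1 cgf1_pos cgf2_pos L] \<alpha>
      by blast
    then show "\<alpha> \<in> cgf1 ` Z" using t by blast
  qed
  then have "finite ?I" "card ?I \<le> card (cgf1 ` Z)"
    using Z(1) by (auto intro: finite_subset card_mono)
  then show ?thesis using card_image_le[OF Z(1), of cgf1] Z(2) by linarith
qed

end

theorem theorem4p3:
  fixes n n1 n2 n3 :: nat and a b :: "nat \<Rightarrow> real" and T :: "real \<Rightarrow> real"
    and x1 x2 x3 :: real
  assumes "pl_expanding_map n a b T"
    and "essential_branch_number n a b = 3"
    and "x1 < x2" and "x2 < x3"
    and "n1 \<ge> 1" and "n2 \<ge> 1" and "n3 \<ge> 1"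
    and "card {i. i < n \<and> slope a b i = x1} = n1"
    and "card {i. i < n \<and> slope a b i = x2} = n2"
    and "card {i. i < n \<and> slope a b i = x3} = n3"
  shows "finite (lyapunov_inflections n a b T) \<and> card (lyapunov_inflections n a b T) \<le> 6"
proof -
  note map = assms(1)[unfolded pl_expanding_map_def]
  obtain p q :: "nat \<Rightarrow> real" where
    "\<forall>i<n. (\<lambda>x. p i * x + q i) ` {a i..b i} = {0..1}"
    "\<forall>x \<in> pl_domain n a b. \<exists>i<n. x \<in> {a i..b i} \<and> T x = p i * x + q i"
    using map by blast
  then interpret pl_map n a b p q T
    using map by unfold_locales auto
  have mem: "x \<in> slopes n a b" if "card {i. i < n \<and> slope a b i = x} \<ge> 1" for x
  proof -
    have "{i. i < n \<and> slope a b i = x} \<noteq> {}" using that by (metis card.empty not_one_le_zero)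
    then show ?thesis by (auto simp: slopes_def)
  qed
  \<comment> \<open>All three given slopes occur, and their number equals the essential branch
    number, so there are no others.\<close>
  have sl: "slopes n a b = {x1, x2, x3}"
  proof (rule card_seteq[symmetric])
    show "finite (slopes n a b)" by (simp add: slopes_def)
    show "{x1, x2, x3} \<subseteq> slopes n a b" using mem assms(5-10) by auto
    show "card (slopes n a b) \<le> card {x1, x2, x3}"
      using assms(2-4) by (simp add: essential_branch_number_def)
  qed
  have gt1: "x > 1" if "x \<in> slopes n a b" for x
    using that branch_bounds by (auto simp: slopes_def)
  have x1: "1 < x1" using gt1 sl by simp
  interpret E: three_exponentials "real n1" "real n2" "real n3" "ln x1" "ln x2" "ln x3"
    using assms(3-7) x1 by unfold_locales auto
  \<comment> \<open>Grouping branches by slope makes the multiplicities the weights of three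
    exponentials. The partition sum and the numerator of the mean are the cases g y = exp(t y) and g
    y = y exp(t y).\<close>
  have group: "(\<Sum>i<n. g (log_slope i)) = real n1 * g (ln x1) + real n2 * g (ln x2) + real n3 * g (ln x3)"
    for g :: "real \<Rightarrow> real"
  proof -
    have "(\<Sum>i<n. g (log_slope i)) = (\<Sum>i<n. g (ln (slope a b i)))"
      by (intro sum.cong) (auto simp: log_slope_def abs_branch_slope)
    also have "\<dots> = (\<Sum>x\<in>slopes n a b. \<Sum>i\<in>{i \<in> {..<n}. slope a b i = x}. g (ln (slope a b i)))"
      unfolding slopes_def by (rule sum.group[symmetric]) auto
    also have "\<dots> = (\<Sum>x\<in>slopes n a b. real (card {i. i < n \<and> slope a b i = x}) * g (ln x))"
      by (intro sum.cong) auto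
    also have "\<dots> = real n1 * g (ln x1) + real n2 * g (ln x2) + real n3 * g (ln x3)"
      unfolding sl using assms(3,4,8-10) by simp
    finally show ?thesis .
  qed
  have F: "partition_sum t = E.moment 0 t" for t
    unfolding partition_sum_def E.moment_def using group[of "\<lambda>y. exp (t * y)"] by simp
  have F1: "mean_log_slope t = E.cgf1 t" for t
    unfolding mean_log_slope_def E.cgf1_def F E.moment_def[of 1]
    using group[of "\<lambda>y. y * exp (t * y)"] by (simp add: mult.assoc)
  have "lyapunov_spectrum (pl_domain n a b) T (E.cgf1 t) = E.cgf t / E.cgf1 t - t" for t
    using lyapunov_spectrum_eq[of t] by (simp add: F1 pressure_def E.cgf_def F)
  note E.card_legendre_inflections[OF this]
  moreover have "Min (slopes n a b) = x1" "Max (slopes n a b) = x3"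
    unfolding sl using assms(3,4) by auto
  ultimately show ?thesis by (auto simp: lyapunov_inflections_def)
qed

end
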